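(* Suppose $G$ is a topological group containing a closed, co-precompact, extremely amenable subgroup $H$. Then $G$ is CAP. If $H$ is also pre-syndetic, then $\widehat{G/H} \cong \mathrm{M}(G)$ (as $G$-flows).
   Context: All topological groups and spaces are Hausdorff. For a topological group $G$, a $G$-flow is a (non-empty) compact Hausdorff space with a continuous left action of $G$; a $G$-map is a continuous $G$-equivariant map; a subflow is a non-empty closed $G$-invariant subset; a flow is minimal if it has no proper subflow. For a $G$-flow $X$, $\mathrm{AP}_G(X)=\{x\in X:\overline{Gx}\text{ is minimal}\}$. $G$ is CAP if $\mathrm{AP}_G(X)$ is closed in $X$ for every $G$-flow $X$. $\mathrm{M}(G)$ is the universal minimal flow of $G$: the minimal $G$-flow, unique up to isomorphism, admitting a $G$-map onto every minimal $G$-flow. A topological group $H$ is extremely amenable if $\mathrm{M}(H)$ is a singleton (equivalently every $H$-flow has an $H$-fixed point). For a closed subgroup $H\subseteq G$, the left coset space $G/H$ is a uniform space whose basic entourages are $\{(gH,kH): gHk^{-1}\cap U\ne\emptyset\}$ for $U$ a symmetric open neighborhood of $1_G$. $\widehat{G/H}$ is the completion of this uniform space; the left translation action of $G$ on $G/H$ extends to $\widehat{G/H}$. $H$ is co-precompact in $G$ if $\widehat{G/H}$ is compact; equivalently, for every neighborhood $U$ of $1_G$ there is a finite $F\subseteq G$ with $UFH=G$. When $H$ is co-precompact, $\widehat{G/H}$ is a $G$-flow. A subset $S\subseteq G$ is pre-syndetic if for every neighborhood $U$ of $1_G$ there is a finite $F\subseteq G$ with $FUS=G$. *)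

theory Defs
  imports "HOL-Analysis.Analysis" "HOL-Algebra.Left_Coset" "HOL-Algebra.Group_Action"
begin

no_notation eq_closure_of (\<open>closure'_of\<index>\<close>)

section \<open>Topological groups and flows\<close>

locale topological_group = group G for G (structure) +
  fixes T :: "'a topology"
  assumes topspace_eq: "topspace T = carrier G"
    and Hausdorff: "Hausdorff_space T"
    and continuous_mult: "continuous_map (prod_topology T T) T (\<lambda>(x, y). x \<otimes> y)"
    and continuous_inv: "continuous_map T T (\<lambda>x. inv x)"

text \<open>A flow on the space \<open>X\<close> is given by an action \<open>\<phi>\<close> in the sense of
  \<^locale>\<open>group_action\<close>: each \<open>\<phi> g\<close> is a permutation of \<open>topspace X\<close>
  that is \<open>undefined\<close> elsewhere.\<close>

definition flow :: "('g, 'b) monoid_scheme \<Rightarrow> 'g topology \<Rightarrow> 'x topology \<Rightarrow> ('g \<Rightarrow> 'x \<Rightarrow> 'x) \<Rightarrow> bool"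
  where "flow G T X \<phi> \<longleftrightarrow>
    topspace X \<noteq> {} \<and> compact_space X \<and> Hausdorff_space X \<and>
    group_action G (topspace X) \<phi> \<and>
    continuous_map (prod_topology T X) X (\<lambda>(g, x). \<phi> g x)"

definition subflow :: "('g, 'b) monoid_scheme \<Rightarrow> 'x topology \<Rightarrow> ('g \<Rightarrow> 'x \<Rightarrow> 'x) \<Rightarrow> 'x set \<Rightarrow> bool"
  where "subflow G X \<phi> S \<longleftrightarrow>
    S \<noteq> {} \<and> closedin X S \<and> (\<forall>g\<in>carrier G. \<phi> g ` S \<subseteq> S)"

definition minimal_flow ::
    "('g, 'b) monoid_scheme \<Rightarrow> 'g topology \<Rightarrow> 'x topology \<Rightarrow> ('g \<Rightarrow> 'x \<Rightarrow> 'x) \<Rightarrow> bool"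
  where "minimal_flow G T X \<phi> \<longleftrightarrow>
    flow G T X \<phi> \<and> (\<forall>S. subflow G X \<phi> S \<longrightarrow> S = topspace X)"

definition flow_map ::
    "('g, 'b) monoid_scheme \<Rightarrow> 'x topology \<Rightarrow> ('g \<Rightarrow> 'x \<Rightarrow> 'x) \<Rightarrow>
     'y topology \<Rightarrow> ('g \<Rightarrow> 'y \<Rightarrow> 'y) \<Rightarrow> ('x \<Rightarrow> 'y) \<Rightarrow> bool"
  where "flow_map G X \<phi> Y \<psi> f \<longleftrightarrow>
    continuous_map X Y f \<and> (\<forall>g\<in>carrier G. \<forall>x\<in>topspace X. f (\<phi> g x) = \<psi> g (f x))"

definition flow_isomorphic ::
    "('g, 'b) monoid_scheme \<Rightarrow> 'x topology \<Rightarrow> ('g \<Rightarrow> 'x \<Rightarrow> 'x) \<Rightarrow>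
     'y topology \<Rightarrow> ('g \<Rightarrow> 'y \<Rightarrow> 'y) \<Rightarrow> bool"
  where "flow_isomorphic G X \<phi> Y \<psi> \<longleftrightarrow>
    (\<exists>f. homeomorphic_map X Y f \<and> flow_map G X \<phi> Y \<psi> f)"

definition almost_periodic_points ::
    "('g, 'b) monoid_scheme \<Rightarrow> 'g topology \<Rightarrow> 'x topology \<Rightarrow> ('g \<Rightarrow> 'x \<Rightarrow> 'x) \<Rightarrow> 'x set"
  where "almost_periodic_points G T X \<phi> =
    {x \<in> topspace X. let C = X closure_of (orbit G \<phi> x) in
       minimal_flow G T (subtopology X C) (\<lambda>g. restrict (\<phi> g) C)}"

text \<open>A definition cannot quantify over types, so the type of points of the flows is an
  argument; a group is CAP if \<open>CAP TYPE('x) G T\<close> holds for every type \<open>'x\<close>.\<close>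

definition CAP :: "'x itself \<Rightarrow> ('g, 'b) monoid_scheme \<Rightarrow> 'g topology \<Rightarrow> bool"
  where "CAP t G T \<longleftrightarrow>
    (\<forall>(X :: 'x topology) \<phi>. flow G T X \<phi> \<longrightarrow> closedin X (almost_periodic_points G T X \<phi>))"

text \<open>\<open>is_universal_minimal_flow G T M \<mu>\<close> says that \<open>M\<close> is (a copy of) \<open>M(G)\<close>.
  The flows onto which \<open>M\<close> is required to map have points in the fixed type \<open>'g set set\<close>.
  This is no loss of generality: if \<open>x\<close> is a point of a minimal flow, its orbit is dense, and
  \<open>y \<mapsto> {A. A \<subseteq> G \<and> y \<in> closure (A x)}\<close> is injective. See
  \<open>universal_minimal_flow_any_type\<close> below.\<close>

definition is_universal_minimal_flow ::
    "('g, 'b) monoid_scheme \<Rightarrow> 'g topology \<Rightarrow> 'x topology \<Rightarrow> ('g \<Rightarrow> 'x \<Rightarrow> 'x) \<Rightarrow> bool"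
  where "is_universal_minimal_flow G T M \<mu> \<longleftrightarrow>
    minimal_flow G T M \<mu> \<and>
    (\<forall>(Y :: 'g set set topology) \<psi>. minimal_flow G T Y \<psi> \<longrightarrow>
       (\<exists>f. flow_map G M \<mu> Y \<psi> f \<and> f ` topspace M = topspace Y))"

definition extremely_amenable :: "('g, 'b) monoid_scheme \<Rightarrow> 'g topology \<Rightarrow> bool"
  where "extremely_amenable G T \<longleftrightarrow>
    (\<exists>(M :: 'g set set topology) \<mu>. is_universal_minimal_flow G T M \<mu> \<and> is_singleton (topspace M))"


section \<open>Completion of a uniform space with a carrier\<close>

text \<open>A uniformity on a set \<open>S\<close> is a filter \<open>\<U>\<close> on pairs with \<open>\<U> \<le> principal (S \<times> S)\<close>.
  The next two definitions relativise the type class notions \<^class>\<open>uniform_space\<close> and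
  \<^const>\<open>cauchy_filter\<close>.\<close>

definition uniform_topology :: "'a set \<Rightarrow> ('a \<times> 'a) filter \<Rightarrow> 'a topology"
  where "uniform_topology S \<U> =
    topology (\<lambda>V. V \<subseteq> S \<and> (\<forall>x\<in>V. \<forall>\<^sub>F (x', y) in \<U>. x' = x \<longrightarrow> y \<in> V))"

definition cauchy_filter_on :: "'a set \<Rightarrow> ('a \<times> 'a) filter \<Rightarrow> 'a filter \<Rightarrow> bool"
  where "cauchy_filter_on S \<U> F \<longleftrightarrow> F \<noteq> bot \<and> F \<le> principal S \<and> F \<times>\<^sub>F F \<le> \<U>"

text \<open>The points of the (Hausdorff) completion are the minimal Cauchy filters. Minimality is with
  respect to inclusion of filters as families of sets, which is the reverse of the order
  \<open>\<le>\<close> on the type \<open>filter\<close>. A basic entourage of the completion consists of the pairs of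
  minimal Cauchy filters that have a common \<open>E\<close>-small member, \<open>E\<close> an entourage.\<close>

definition completion_points :: "'a set \<Rightarrow> ('a \<times> 'a) filter \<Rightarrow> 'a filter set"
  where "completion_points S \<U> =
    {F. cauchy_filter_on S \<U> F \<and> (\<forall>F'. cauchy_filter_on S \<U> F' \<and> F \<le> F' \<longrightarrow> F' = F)}"

definition completion_uniformity ::
    "'a set \<Rightarrow> ('a \<times> 'a) filter \<Rightarrow> ('a filter \<times> 'a filter) filter"
  where "completion_uniformity S \<U> =
    (INF E\<in>{E. \<forall>\<^sub>F p in \<U>. p \<in> E}.
       principal {(F, F'). F \<in> completion_points S \<U> \<and> F' \<in> completion_points S \<U> \<and>
         (\<exists>A. A \<times> A \<subseteq> E \<and> (\<forall>\<^sub>F x in F. x \<in> A) \<and> (\<forall>\<^sub>F x in F'. x \<in> A))})"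

definition completion_topology :: "'a set \<Rightarrow> ('a \<times> 'a) filter \<Rightarrow> 'a filter topology"
  where "completion_topology S \<U> =
    uniform_topology (completion_points S \<U>) (completion_uniformity S \<U>)"


section \<open>Coset spaces\<close>

definition coset_uniformity ::
    "('g, 'b) monoid_scheme \<Rightarrow> 'g topology \<Rightarrow> 'g set \<Rightarrow> ('g set \<times> 'g set) filter"
  where "coset_uniformity G T H =
    (INF U\<in>{U. openin T U \<and> \<one>\<^bsub>G\<^esub> \<in> U \<and> set_inv\<^bsub>G\<^esub> U = U}.
       principal {(g <#\<^bsub>G\<^esub> H, k <#\<^bsub>G\<^esub> H) | g k. g \<in> carrier G \<and> k \<in> carrier G \<and>
         (g <#\<^bsub>G\<^esub> H #>\<^bsub>G\<^esub> inv\<^bsub>G\<^esub> k) \<inter> U \<noteq> {}})"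

definition coset_completion ::
    "('g, 'b) monoid_scheme \<Rightarrow> 'g topology \<Rightarrow> 'g set \<Rightarrow> 'g set filter topology"
  where "coset_completion G T H = completion_topology (lcosets\<^bsub>G\<^esub> H) (coset_uniformity G T H)"

text \<open>Left translation by \<open>g\<close> is a uniform automorphism of the coset space; its extension to the
  completion sends a minimal Cauchy filter to its image filter.\<close>

definition coset_completion_action ::
    "('g, 'b) monoid_scheme \<Rightarrow> 'g topology \<Rightarrow> 'g set \<Rightarrow> 'g \<Rightarrow> 'g set filter \<Rightarrow> 'g set filter"
  where "coset_completion_action G T H g =
    restrict (filtermap (\<lambda>C. g <#\<^bsub>G\<^esub> C)) (topspace (coset_completion G T H))"

definition co_precompact :: "('g, 'b) monoid_scheme \<Rightarrow> 'g topology \<Rightarrow> 'g set \<Rightarrow> bool"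
  where "co_precompact G T H \<longleftrightarrow> compact_space (coset_completion G T H)"

definition pre_syndetic :: "('g, 'b) monoid_scheme \<Rightarrow> 'g topology \<Rightarrow> 'g set \<Rightarrow> bool"
  where "pre_syndetic G T S \<longleftrightarrow>
    (\<forall>U. U \<subseteq> carrier G \<and> (\<exists>V. openin T V \<and> \<one>\<^bsub>G\<^esub> \<in> V \<and> V \<subseteq> U) \<longrightarrow>
       (\<exists>F. finite F \<and> F \<subseteq> carrier G \<and> F <#>\<^bsub>G\<^esub> U <#>\<^bsub>G\<^esub> S = carrier G))"


section \<open>Basic facts\<close>

lemma openin_uniform_topology:
  "openin (uniform_topology S \<U>) V \<longleftrightarrow>
     V \<subseteq> S \<and> (\<forall>x\<in>V. \<forall>\<^sub>F (x', y) in \<U>. x' = x \<longrightarrow> y \<in> V)"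
proof -
  have "istopology (\<lambda>V. V \<subseteq> S \<and> (\<forall>x\<in>V. \<forall>\<^sub>F (x', y) in \<U>. x' = x \<longrightarrow> y \<in> V))"
    unfolding istopology_def
  proof (intro conjI allI impI)
    fix A B
    assume A: "A \<subseteq> S \<and> (\<forall>x\<in>A. \<forall>\<^sub>F (x', y) in \<U>. x' = x \<longrightarrow> y \<in> A)"
      and B: "B \<subseteq> S \<and> (\<forall>x\<in>B. \<forall>\<^sub>F (x', y) in \<U>. x' = x \<longrightarrow> y \<in> B)"
    show "A \<inter> B \<subseteq> S" using A by auto
    show "\<forall>x\<in>A \<inter> B. \<forall>\<^sub>F (x', y) in \<U>. x' = x \<longrightarrow> y \<in> A \<inter> B"
    proof
      fix x assume "x \<in> A \<inter> B"
      with A B have "\<forall>\<^sub>F (x', y) in \<U>. x' = x \<longrightarrow> y \<in> A"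
        "\<forall>\<^sub>F (x', y) in \<U>. x' = x \<longrightarrow> y \<in> B" by auto
      then show "\<forall>\<^sub>F (x', y) in \<U>. x' = x \<longrightarrow> y \<in> A \<inter> B"
        by eventually_elim auto
    qed
  next
    fix K
    assume K: "\<forall>V\<in>K. V \<subseteq> S \<and> (\<forall>x\<in>V. \<forall>\<^sub>F (x', y) in \<U>. x' = x \<longrightarrow> y \<in> V)"
    then show "\<Union>K \<subseteq> S" by auto
    show "\<forall>x\<in>\<Union>K. \<forall>\<^sub>F (x', y) in \<U>. x' = x \<longrightarrow> y \<in> \<Union>K"
    proof
      fix x assume "x \<in> \<Union>K"
      then obtain V where V: "V \<in> K" "x \<in> V" by auto
      with K have "\<forall>\<^sub>F (x', y) in \<U>. x' = x \<longrightarrow> y \<in> V" by auto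
      then show "\<forall>\<^sub>F (x', y) in \<U>. x' = x \<longrightarrow> y \<in> \<Union>K"
        by eventually_elim (use V in auto)
    qed
  qed
  then show ?thesis by (simp add: uniform_topology_def)
qed

lemma topspace_uniform_topology:
  assumes "\<U> \<le> principal (S \<times> S)"
  shows "topspace (uniform_topology S \<U>) = S"
proof -
  have "\<forall>\<^sub>F p in \<U>. p \<in> S \<times> S"
    using assms by (auto simp: le_principal)
  then have "openin (uniform_topology S \<U>) S"
    by (auto simp: openin_uniform_topology elim!: eventually_mono)
  then show ?thesis
    by (metis openin_subset openin_topspace openin_uniform_topology subset_antisym)
qed

lemma topspace_coset_completion:
  "topspace (coset_completion G T H) =
     completion_points (lcosets\<^bsub>G\<^esub> H) (coset_uniformity G T H)"
proof -
  let ?C = "completion_points (lcosets\<^bsub>G\<^esub> H) (coset_uniformity G T H)"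
  have "completion_uniformity (lcosets\<^bsub>G\<^esub> H) (coset_uniformity G T H) \<le> principal (?C \<times> ?C)"
    unfolding completion_uniformity_def
    by (rule INF_lower2[of UNIV]) auto
  then show ?thesis
    by (simp add: coset_completion_def completion_topology_def topspace_uniform_topology)
qed

context
  fixes G :: "('g, 'b) monoid_scheme" and T :: "'g topology"
    and X :: "'x topology" and \<phi> :: "'g \<Rightarrow> 'x \<Rightarrow> 'x"
  assumes G: "topspace T = carrier G" and fl: "flow G T X \<phi>"
begin

interpretation group_action G "topspace X" \<phi>
  using fl by (simp add: flow_def)

lemma flow_continuous_translation:
  assumes "g \<in> carrier G"
  shows "continuous_map X X (\<phi> g)"
proof -
  have "continuous_map X (prod_topology T X) (\<lambda>x. (g, x))"
    using assms G by (auto intro!: continuous_map_pairedI)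
  then have "continuous_map X X ((\<lambda>(g, x). \<phi> g x) \<circ> (\<lambda>x. (g, x)))"
    using fl by (auto simp: flow_def intro: continuous_map_compose)
  then show ?thesis by (simp add: o_def)
qed

lemma minimal_flow_dense_orbit:
  assumes min: "minimal_flow G T X \<phi>" and x: "x \<in> topspace X"
  shows "X closure_of orbit G \<phi> x = topspace X"
proof -
  have gr: "group G" using group_hom by (simp add: group_hom_def)
  have orb: "orbit G \<phi> x \<subseteq> topspace X"
    using x element_image by (auto simp: orbit_def)
  have "x \<in> orbit G \<phi> x"
    using x gr id_eq_one by (metis (mono_tags, lifting) group.is_monoid mem_Collect_eq monoid.one_closed orbit_def restrict_apply')
  then have ne: "X closure_of orbit G \<phi> x \<noteq> {}"
    using closure_of_subset[OF orb] by auto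
  have "\<phi> g ` (X closure_of orbit G \<phi> x) \<subseteq> X closure_of orbit G \<phi> x" if g: "g \<in> carrier G" for g
  proof -
    have "\<phi> g ` (X closure_of orbit G \<phi> x) \<subseteq> X closure_of (\<phi> g ` orbit G \<phi> x)"
      using flow_continuous_translation[OF g] continuous_map_image_closure_subset by blast
    also have "\<phi> g ` orbit G \<phi> x \<subseteq> orbit G \<phi> x"
    proof
      fix y assume "y \<in> \<phi> g ` orbit G \<phi> x"
      then obtain h where h: "h \<in> carrier G" "y = \<phi> g (\<phi> h x)" by (auto simp: orbit_def)
      then have "y = \<phi> (g \<otimes>\<^bsub>G\<^esub> h) x" using composition_rule[OF x g h(1)] by simp
      then show "y \<in> orbit G \<phi> x"
        using g h gr by (auto simp: orbit_def intro: group.is_monoid monoid.m_closed)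
    qed
    finally show ?thesis by (meson closure_of_mono order_trans)
  qed
  then have "subflow G X \<phi> (X closure_of orbit G \<phi> x)"
    using ne by (simp add: subflow_def)
  then show ?thesis using min by (simp add: minimal_flow_def)
qed

lemma minimal_flow_embedding:
  assumes min: "minimal_flow G T X \<phi>"
  obtains e :: "'x \<Rightarrow> 'g set set" where "inj_on e (topspace X)"
proof -
  obtain x where x: "x \<in> topspace X" using fl unfolding flow_def by blast
  define e where "e = (\<lambda>y. {A. A \<subseteq> carrier G \<and> y \<in> X closure_of ((\<lambda>g. \<phi> g x) ` A)})"
  have orb: "orbit G \<phi> x \<subseteq> topspace X"
    using x element_image by (auto simp: orbit_def)
  have "inj_on e (topspace X)"
  proof (rule inj_onI, rule ccontr)
    fix y z assume yz: "y \<in> topspace X" "z \<in> topspace X" "e y = e z" "y \<noteq> z"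
    then obtain U V where UV: "openin X U" "openin X V" "y \<in> U" "z \<in> V" "disjnt U V"
      using fl unfolding flow_def Hausdorff_space_def by metis
    define A where "A = {g \<in> carrier G. \<phi> g x \<in> U}"
    have A: "(\<lambda>g. \<phi> g x) ` A = U \<inter> orbit G \<phi> x"
      by (auto simp: A_def orbit_def)
    have "y \<in> X closure_of orbit G \<phi> x"
      using minimal_flow_dense_orbit[OF min x] yz by simp
    then have "y \<in> X closure_of (U \<inter> orbit G \<phi> x)"
      using UV openin_Int_closure_of_subset by (metis IntI subsetD)
    moreover have "A \<subseteq> carrier G" by (auto simp: A_def)
    ultimately have "A \<in> e y" by (simp add: e_def A)
    then have "A \<in> e z" using yz(3) by simp
    then have "z \<in> X closure_of (U \<inter> orbit G \<phi> x)"
      by (simp add: e_def A)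
    then have "V \<inter> (U \<inter> orbit G \<phi> x) \<noteq> {}"
      using UV unfolding in_closure_of by blast
    then show False using UV(5) by (auto simp: disjnt_def)
  qed
  then show ?thesis by (rule that)
qed

text \<open>Transport of a minimal flow along a homeomorphism.\<close>

lemma minimal_flow_transport:
  fixes Y :: "'y topology"
  assumes min: "minimal_flow G T X \<phi>" and hm: "homeomorphic_maps X Y e d"
  defines "\<psi> \<equiv> \<lambda>g. \<lambda>y\<in>topspace Y. e (\<phi> g (d y))"
  shows "minimal_flow G T Y \<psi>" "flow_map G X \<phi> Y \<psi> e" "flow_map G Y \<psi> X \<phi> d"
proof -
  have gr: "group G" using group_hom by (simp add: group_hom_def)
  have ce: "continuous_map X Y e" and cd: "continuous_map Y X d"
    and de: "\<And>x. x \<in> topspace X \<Longrightarrow> d (e x) = x" and ed: "\<And>y. y \<in> topspace Y \<Longrightarrow> e (d y) = y"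
    using hm by (auto simp: homeomorphic_maps_def)
  have eY: "\<And>x. x \<in> topspace X \<Longrightarrow> e x \<in> topspace Y" and dX: "\<And>y. y \<in> topspace Y \<Longrightarrow> d y \<in> topspace X"
    using ce cd by (auto simp: continuous_map_def)
  have \<phi>X: "\<And>g x. g \<in> carrier G \<Longrightarrow> x \<in> topspace X \<Longrightarrow> \<phi> g x \<in> topspace X"
    using element_image by blast
  have homeo: "X homeomorphic_space Y" using hm by (auto simp: homeomorphic_space_def)
  have bij: "\<psi> g \<in> Bij (topspace Y)" if g: "g \<in> carrier G" for g
  proof -
    have "bij_betw e (topspace X) (topspace Y)" "bij_betw d (topspace Y) (topspace X)"
      using de ed eY dX by (auto intro!: bij_betw_byWitness[where f' = d] bij_betw_byWitness[where f' = e])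
    moreover have "bij_betw (\<phi> g) (topspace X) (topspace X)"
      using bij_prop0[OF g] by (simp add: Bij_def)
    ultimately have "bij_betw (e \<circ> \<phi> g \<circ> d) (topspace Y) (topspace Y)"
      by (meson bij_betw_trans)
    then have "bij_betw (\<psi> g) (topspace Y) (topspace Y)"
      by (simp add: \<psi>_def o_def cong: bij_betw_cong)
    then show ?thesis by (simp add: Bij_def \<psi>_def)
  qed
  have act: "group_action G (topspace Y) \<psi>"
    unfolding group_action_def group_hom_def group_hom_axioms_def
  proof (intro conjI gr group_BijGroup homI)
    fix g assume g: "g \<in> carrier G"
    then show "\<psi> g \<in> carrier (BijGroup (topspace Y))" using bij by (simp add: BijGroup_def)
    fix h assume h: "h \<in> carrier G"
    show "\<psi> (g \<otimes>\<^bsub>G\<^esub> h) = \<psi> g \<otimes>\<^bsub>BijGroup (topspace Y)\<^esub> \<psi> h"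
    proof
      fix y
      show "\<psi> (g \<otimes>\<^bsub>G\<^esub> h) y = (\<psi> g \<otimes>\<^bsub>BijGroup (topspace Y)\<^esub> \<psi> h) y"
      proof (cases "y \<in> topspace Y")
        case True
        then have "\<psi> h y = e (\<phi> h (d y))" "e (\<phi> h (d y)) \<in> topspace Y"
          using eY dX \<phi>X h by (auto simp: \<psi>_def)
        then show ?thesis using True bij[OF g] bij[OF h] composition_rule[OF dX[OF True] g h]
          by (simp add: BijGroup_def compose_def de dX \<phi>X h \<psi>_def)
      next
        case False
        then show ?thesis using bij[OF g] bij[OF h]
          by (simp add: BijGroup_def compose_def \<psi>_def)
      qed
    qed
  qed
  have "continuous_map (prod_topology T Y) (prod_topology T X) (\<lambda>(g, y). (g, d y))"
    by (rule continuous_map_prod_top[THEN iffD2, where f1 = id, simplified id_apply]) (use cd in \<open>auto simp: id_def\<close>)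
  then have "continuous_map (prod_topology T Y) Y (e \<circ> ((\<lambda>(g, x). \<phi> g x) \<circ> (\<lambda>(g, y). (g, d y))))"
    using fl ce by (auto simp: flow_def intro!: continuous_map_compose)
  then have cont: "continuous_map (prod_topology T Y) Y (\<lambda>(g, y). \<psi> g y)"
    by (rule continuous_map_eq) (auto simp: \<psi>_def)
  have "flow G T Y \<psi>"
    unfolding flow_def
    using act cont fl homeo homeomorphic_compact_space homeomorphic_Hausdorff_space
      homeomorphic_empty_space by (metis flow_def null_topspace_iff_trivial)
  moreover have "S = topspace Y" if S: "subflow G Y \<psi> S" for S
  proof -
    have SY: "S \<subseteq> topspace Y" using S by (auto simp: subflow_def dest: closedin_subset)
    have "closedin X (d ` S)"
      using S hm homeomorphic_maps_map homeomorphic_map_closedness_eq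
      unfolding subflow_def by metis
    moreover have "\<phi> g ` d ` S \<subseteq> d ` S" if g: "g \<in> carrier G" for g
    proof clarify
      fix y assume y: "y \<in> S"
      then have "\<psi> g y \<in> S" using S g by (auto simp: subflow_def)
      moreover have "d (\<psi> g y) = \<phi> g (d y)"
        using y SY by (auto simp: \<psi>_def de dX \<phi>X g)
      ultimately show "\<phi> g (d y) \<in> d ` S" by (metis imageI)
    qed
    ultimately have "subflow G X \<phi> (d ` S)" using S by (auto simp: subflow_def)
    then have "d ` S = topspace X" using min by (simp add: minimal_flow_def)
    have "topspace Y \<subseteq> S"
    proof
      fix y assume y: "y \<in> topspace Y"
      then have "d y \<in> d ` S" using \<open>d ` S = topspace X\<close> dX by simp
      then obtain s where "s \<in> S" "d y = d s" by blast
      then show "y \<in> S" using y SY ed by (metis subsetD)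
    qed
    then show ?thesis using SY by blast
  qed
  ultimately show "minimal_flow G T Y \<psi>" by (simp add: minimal_flow_def)
  show "flow_map G X \<phi> Y \<psi> e" "flow_map G Y \<psi> X \<phi> d"
    using ce cd by (auto simp: flow_map_def \<psi>_def de eY dX \<phi>X)
qed

end

theorem universal_minimal_flow_any_type:
  fixes G :: "('g, 'b) monoid_scheme" and Y :: "'y topology"
  assumes G: "topspace T = carrier G"
    and M: "is_universal_minimal_flow G T M \<mu>" and Y: "minimal_flow G T Y \<psi>"
  shows "\<exists>f. flow_map G M \<mu> Y \<psi> f \<and> f ` topspace M = topspace Y"
proof -
  have fl: "flow G T Y \<psi>" using Y by (simp add: minimal_flow_def)
  obtain e :: "'y \<Rightarrow> 'g set set" where e: "inj_on e (topspace Y)"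
    using minimal_flow_embedding[OF G fl Y] .
  define d where "d = inv_into (topspace Y) e"
  define Z where "Z = pullback_topology (e ` topspace Y) d Y"
  have d: "d (e y) = y" if "y \<in> topspace Y" for y using e that by (simp add: d_def)
  have tZ: "topspace Z = e ` topspace Y"
    unfolding Z_def topspace_pullback_topology using d by auto
  have "continuous_map Z Y d"
    unfolding Z_def using continuous_map_pullback[of Y Y id] by simp
  moreover have "continuous_map Y Z e"
    unfolding Z_def
    by (rule continuous_map_pullback') (auto intro: continuous_map_eq[OF continuous_map_id] simp: d)
  ultimately have hm: "homeomorphic_maps Y Z e d"
    by (auto simp: homeomorphic_maps_def tZ d)
  define \<zeta> where "\<zeta> = (\<lambda>g. \<lambda>z\<in>topspace Z. e (\<psi> g (d z)))"
  have "minimal_flow G T Z \<zeta>" and dm: "flow_map G Z \<zeta> Y \<psi> d"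
    unfolding \<zeta>_def using minimal_flow_transport[OF G fl Y hm] by auto
  then obtain f where f: "flow_map G M \<mu> Z \<zeta> f" "f ` topspace M = topspace Z"
    using M unfolding is_universal_minimal_flow_def by blast
  have "d ` topspace Z = topspace Y" using d by (force simp: tZ)
  then have "(d \<circ> f) ` topspace M = topspace Y" using f(2) by (metis image_comp)
  moreover have "flow_map G M \<mu> Y \<psi> (d \<circ> f)"
    unfolding flow_map_def
  proof (intro conjI ballI)
    show "continuous_map M Y (d \<circ> f)"
      using f dm by (auto simp: flow_map_def intro: continuous_map_compose)
    fix g x assume gx: "g \<in> carrier G" "x \<in> topspace M"
    then have "f x \<in> topspace Z" using f(2) by blast
    then show "(d \<circ> f) (\<mu> g x) = \<psi> g ((d \<circ> f) x)"
      using f(1) dm gx by (simp add: flow_map_def)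
  qed
  ultimately show ?thesis by blast
qed

corollary extremely_amenable_minimal_flow_singleton:
  assumes "topspace T = carrier G" "extremely_amenable G T" "minimal_flow G T Y \<psi>"
  shows "is_singleton (topspace Y)"
proof -
  obtain M :: "'a set set topology" and \<mu>
    where M: "is_universal_minimal_flow G T M \<mu>" "is_singleton (topspace M)"
    using assms(2) by (auto simp: extremely_amenable_def)
  then obtain f where "f ` topspace M = topspace Y"
    using universal_minimal_flow_any_type[OF assms(1) M(1) assms(3)] by blast
  then show ?thesis using M(2) by (metis image_empty image_insert is_singleton_def)
qed

end

theory Submission
  imports Defs
begin

text \<open>Let \<open>Y\<close> be the completion of \<open>G/H\<close>.  It is a \<open>G\<close>-flow, and the orbit of its base point, the coset
\<open>H\<close>, is dense.  If \<open>x\<close> is an \<open>H\<close>-fixed point of a flow \<open>X\<close>, then \<open>gH \<mapsto> gx\<close> is well defined and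
uniformly continuous, because cosets that are close have the form \<open>gH\<close> and \<open>ugH\<close> with \<open>u\<close> near the
identity, and \<open>ugx\<close> is then close to \<open>gx\<close>, uniformly in \<open>x\<close>.  So it extends to a \<open>G\<close>-map
\<open>\<lambda>p. extend p x\<close> from \<open>Y\<close> to \<open>X\<close>, and since the estimate is uniform in \<open>x\<close> the map
\<open>(p, x) \<mapsto> extend p x\<close> is jointly continuous on \<open>Y \<times> Fix\<^sub>H(X)\<close> (\<open>extend_continuous\<close>).

Extreme amenability puts an \<open>H\<close>-fixed point into every non-empty closed \<open>H\<close>-invariant set
(\<open>extremely_amenable_fixed_point\<close>), in particular into every minimal subflow of \<open>X\<close>.  Fix a minimal
subflow \<open>M\<close> of \<open>Y\<close>.  The maps \<open>\<lambda>p. extend p x\<close> send \<open>M\<close> onto minimal subflows, and every minimal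
subflow \<open>S\<close> of \<open>X\<close> is reached, by any fixed point \<open>x\<close> in \<open>S\<close>.  The set of almost periodic points, which is
the union of the minimal subflows, is therefore the image of the compact set \<open>M \<times> Fix\<^sub>H(X)\<close>, and
\<open>G\<close> is CAP.

If \<open>H\<close> is pre-syndetic, then every orbit closure in \<open>Y\<close> contains the base point
(\<open>pre_syndetic_base_point\<close>), so \<open>Y\<close> is minimal; it maps onto every minimal flow because that flow has
an \<open>H\<close>-fixed point.  For the isomorphism with an arbitrary universal minimal flow it suffices that
\<open>G\<close>-endomorphisms of \<open>Y\<close> are injective.  An endomorphism \<open>e\<close> is onto, the fibre of \<open>e\<close> over the base
point is closed and \<open>H\<close>-invariant, so it contains an \<open>H\<close>-fixed point \<open>q\<close>, and
\<open>\<lambda>p. extend p q\<close> is a right inverse of \<open>e\<close> (\<open>endomorphism_right_inverse\<close>); being itself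
onto, it is an inverse.\<close>


section \<open>Neighbourhoods of the identity\<close>

lemma openin_prod_box:
  assumes "openin (prod_topology X Y) W" "(x, y) \<in> W"
  obtains A B where "openin X A" "openin Y B" "x \<in> A" "y \<in> B" "A \<times> B \<subseteq> W"
  using assms(1)[unfolded openin_prod_topology_alt, rule_format, OF assms(2)] by blast

context topological_group
begin

definition sym_nbhds :: "'a set set"
  where "sym_nbhds = {U. openin T U \<and> \<one> \<in> U \<and> set_inv U = U}"

lemma sym_nbhds_carrier: "U \<in> sym_nbhds \<Longrightarrow> U \<subseteq> carrier G"
  using topspace_eq openin_subset by (auto simp: sym_nbhds_def)

lemma sym_nbhds_one: "U \<in> sym_nbhds \<Longrightarrow> \<one> \<in> U"
  by (simp add: sym_nbhds_def)

lemma sym_nbhds_openin: "U \<in> sym_nbhds \<Longrightarrow> openin T U"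
  by (simp add: sym_nbhds_def)

lemma sym_nbhds_inv: "U \<in> sym_nbhds \<Longrightarrow> u \<in> U \<Longrightarrow> inv u \<in> U"
  by (auto simp: sym_nbhds_def SET_INV_def)

text \<open>The symmetric open sets that index the entourages of \<open>G/H\<close> form a base at the identity.\<close>

lemma sym_nbhds_within:
  assumes W: "openin T W" "\<one> \<in> W"
  obtains U where "U \<in> sym_nbhds" "U \<subseteq> W"
proof -
  define U where "U = W \<inter> {g \<in> topspace T. inv g \<in> W}"
  have sub: "W \<subseteq> carrier G" using W(1) openin_subset topspace_eq by auto
  have "openin T U"
    unfolding U_def using W(1) openin_continuous_map_preimage[OF continuous_inv W(1)] by blast
  moreover have "\<one> \<in> U" using W(2) by (simp add: U_def topspace_eq)
  moreover have "set_inv U = U"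
  proof -
    have "inv g \<in> U" if "g \<in> U" for g
      using that sub by (auto simp: U_def topspace_eq)
    moreover have "g = inv (inv g)" if "g \<in> U" for g
      using that sub by (auto simp: U_def)
    ultimately show ?thesis unfolding SET_INV_def by blast
  qed
  ultimately show ?thesis
    by (intro that[of U]) (auto simp: sym_nbhds_def U_def)
qed

lemma sym_nbhds_carrier_mem: "carrier G \<in> sym_nbhds"
proof -
  obtain U where "U \<in> sym_nbhds" using sym_nbhds_within[of "carrier G"] topspace_eq
    by (metis one_closed openin_topspace)
  have "set_inv (carrier G) = carrier G"
    unfolding SET_INV_def by (auto intro: bexI[of _ "inv _"])
  then show ?thesis using topspace_eq by (metis (mono_tags, lifting) sym_nbhds_def mem_Collect_eq one_closed openin_topspace)
qed

lemma sym_nbhds_Int: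
  assumes "U \<in> sym_nbhds" "V \<in> sym_nbhds"
  shows "U \<inter> V \<in> sym_nbhds"
proof -
  have "inv g \<in> U \<inter> V" "g = inv (inv g)" if "g \<in> U \<inter> V" for g
    using that assms sym_nbhds_inv sym_nbhds_carrier[OF assms(1)] by auto
  then have "set_inv (U \<inter> V) = U \<inter> V" unfolding SET_INV_def by blast
  then show ?thesis using assms by (auto simp: sym_nbhds_def)
qed

lemma sym_nbhds_square:
  assumes U: "U \<in> sym_nbhds"
  obtains V where "V \<in> sym_nbhds" "\<forall>v\<in>V. \<forall>w\<in>V. v \<otimes> w \<in> U"
proof -
  have "openin (prod_topology T T) {p \<in> topspace (prod_topology T T). (\<lambda>(x, y). x \<otimes> y) p \<in> U}"
    using openin_continuous_map_preimage[OF continuous_mult sym_nbhds_openin[OF U]] .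
  moreover have "(\<one>, \<one>) \<in> {p \<in> topspace (prod_topology T T). (\<lambda>(x, y). x \<otimes> y) p \<in> U}"
    using sym_nbhds_one[OF U] by (simp add: topspace_eq)
  ultimately obtain A B where AB: "openin T A" "openin T B" "\<one> \<in> A" "\<one> \<in> B"
    "A \<times> B \<subseteq> {p \<in> topspace (prod_topology T T). (\<lambda>(x, y). x \<otimes> y) p \<in> U}"
    by (rule openin_prod_box)
  have "openin T (A \<inter> B)" "\<one> \<in> A \<inter> B" using AB by auto
  then obtain V where V: "V \<in> sym_nbhds" "V \<subseteq> A \<inter> B"
    by (rule sym_nbhds_within)
  have "\<forall>v\<in>V. \<forall>w\<in>V. v \<otimes> w \<in> U"
    using subset_trans[OF Sigma_mono AB(5), of V "\<lambda>_. V"] V(2) by auto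
  with V(1) show ?thesis by (rule that)
qed

lemma continuous_translation:
  assumes "g \<in> carrier G"
  shows "continuous_map T T (\<lambda>x. x \<otimes> g)" "continuous_map T T (\<lambda>x. g \<otimes> x)"
proof -
  have "continuous_map T (prod_topology T T) (\<lambda>x. (x, g))" "continuous_map T (prod_topology T T) (\<lambda>x. (g, x))"
    using assms topspace_eq by (auto intro!: continuous_map_pairedI)
  then have "continuous_map T T ((\<lambda>(x, y). x \<otimes> y) \<circ> (\<lambda>x. (x, g)))" "continuous_map T T ((\<lambda>(x, y). x \<otimes> y) \<circ> (\<lambda>x. (g, x)))"
    using continuous_mult continuous_map_compose by blast+
  then show "continuous_map T T (\<lambda>x. x \<otimes> g)" "continuous_map T T (\<lambda>x. g \<otimes> x)" by (simp_all add: o_def)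
qed

lemma sym_nbhds_conjugate:
  assumes U: "U \<in> sym_nbhds" and g: "g \<in> carrier G"
  obtains V where "V \<in> sym_nbhds" "\<forall>v\<in>V. g \<otimes> v \<otimes> inv g \<in> U"
proof -
  have "continuous_map T T ((\<lambda>x. x \<otimes> inv g) \<circ> (\<lambda>x. g \<otimes> x))"
    using continuous_translation g by (auto intro: continuous_map_compose)
  then have "openin T {x \<in> topspace T. g \<otimes> x \<otimes> inv g \<in> U}"
    using openin_continuous_map_preimage[OF _ sym_nbhds_openin[OF U]] by (fastforce simp: o_def)
  moreover have "\<one> \<in> {x \<in> topspace T. g \<otimes> x \<otimes> inv g \<in> U}"
    using g sym_nbhds_one[OF U] by (simp add: topspace_eq)
  ultimately obtain V where "V \<in> sym_nbhds" "V \<subseteq> {x \<in> topspace T. g \<otimes> x \<otimes> inv g \<in> U}"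
    by (rule sym_nbhds_within)
  then show ?thesis by (intro that[of V]) auto
qed

lemma openin_translate:
  assumes U: "openin T U" and g: "g \<in> carrier G"
  shows "openin T {x \<in> carrier G. x \<otimes> inv g \<in> U}"
  using openin_continuous_map_preimage[OF continuous_translation(1)[of "inv g"] U] g by (simp add: topspace_eq)

end


section \<open>Subflows\<close>

text \<open>Bijectivity comes for free from the inverses in the group.\<close>

lemma group_actionI:
  assumes G: "group G"
    and closed: "\<And>g x. g \<in> carrier G \<Longrightarrow> x \<in> E \<Longrightarrow> \<phi> g x \<in> E"
    and undef: "\<And>g. g \<in> carrier G \<Longrightarrow> \<phi> g \<in> extensional E"
    and one: "\<And>x. x \<in> E \<Longrightarrow> \<phi> \<one>\<^bsub>G\<^esub> x = x"
    and mult: "\<And>g h x. g \<in> carrier G \<Longrightarrow> h \<in> carrier G \<Longrightarrow> x \<in> E \<Longrightarrow> \<phi> (g \<otimes>\<^bsub>G\<^esub> h) x = \<phi> g (\<phi> h x)"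
  shows "group_action G E \<phi>"
  unfolding group_action_def group_hom_def group_hom_axioms_def
proof (intro conjI G group_BijGroup homI)
  interpret group G by (rule G)
  have Bij: "\<phi> g \<in> Bij E" if g: "g \<in> carrier G" for g
  proof -
    have "\<phi> (inv\<^bsub>G\<^esub> g) (\<phi> g x) = x" "\<phi> g (\<phi> (inv\<^bsub>G\<^esub> g) x) = x" if "x \<in> E" for x
      using mult[of g "inv\<^bsub>G\<^esub> g" x] mult[of "inv\<^bsub>G\<^esub> g" g x] g one that by auto
    then have "bij_betw (\<phi> g) E E"
      using closed g by (intro bij_betw_byWitness[where f' = "\<phi> (inv\<^bsub>G\<^esub> g)"]) auto
    then show ?thesis using undef g by (simp add: Bij_def)
  qed
  fix g assume g: "g \<in> carrier G"
  then show "\<phi> g \<in> carrier (BijGroup E)" using Bij by (simp add: BijGroup_def)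
  fix h assume h: "h \<in> carrier G"
  show "\<phi> (g \<otimes>\<^bsub>G\<^esub> h) = \<phi> g \<otimes>\<^bsub>BijGroup E\<^esub> \<phi> h"
  proof (rule extensionalityI)
    show "\<phi> (g \<otimes>\<^bsub>G\<^esub> h) \<in> extensional E" using undef g h by simp
    show "\<phi> g \<otimes>\<^bsub>BijGroup E\<^esub> \<phi> h \<in> extensional E"
      using Bij g h by (simp add: BijGroup_def)
  qed (use Bij g h mult in \<open>simp add: BijGroup_def compose_def\<close>)
qed

definition minimal_subflow ::
    "('g, 'b) monoid_scheme \<Rightarrow> 'x topology \<Rightarrow> ('g \<Rightarrow> 'x \<Rightarrow> 'x) \<Rightarrow> 'x set \<Rightarrow> bool"
  where "minimal_subflow G X \<phi> S \<longleftrightarrow>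
    subflow G X \<phi> S \<and> (\<forall>S'\<subseteq>S. subflow G X \<phi> S' \<longrightarrow> S' = S)"

locale G_flow = topological_group G T for G (structure) and T +
  fixes X :: "'x topology" and \<phi>
  assumes flow: "flow G T X \<phi>"
begin

sublocale group_action G "topspace X" \<phi>
  using flow by (simp add: flow_def)

lemma Hausdorff_X: "Hausdorff_space X" and compact_X: "compact_space X" and nonempty_X: "topspace X \<noteq> {}"
  using flow by (auto simp: flow_def)

lemma act_one: "x \<in> topspace X \<Longrightarrow> \<phi> \<one> x = x"
  using id_eq_one by (metis restrict_apply')

lemma continuous_act: "g \<in> carrier G \<Longrightarrow> continuous_map X X (\<phi> g)"
  using flow_continuous_translation[OF topspace_eq flow] .

text \<open>This form of continuity at the identity does the work of the uniform structure of the compact space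
  \<open>X\<close>, with the sets \<open>U\<close> as entourages.\<close>

lemma act_near_identity:
  assumes W: "openin X W" "x \<in> W"
  obtains U W' where "U \<in> sym_nbhds" "openin X W'" "x \<in> W'" "\<forall>u\<in>U. \<forall>z\<in>W'. \<phi> u z \<in> W"
proof -
  let ?P = "{p \<in> topspace (prod_topology T X). (\<lambda>(g, x). \<phi> g x) p \<in> W}"
  have "openin (prod_topology T X) ?P"
    using flow unfolding flow_def by (intro openin_continuous_map_preimage[OF _ W(1)]) blast
  moreover have "(\<one>, x) \<in> ?P"
    using W openin_subset act_one by (fastforce simp: topspace_eq)
  ultimately obtain A B where AB: "openin T A" "openin X B" "\<one> \<in> A" "x \<in> B" "A \<times> B \<subseteq> ?P"
    by (rule openin_prod_box)
  obtain V where V: "V \<in> sym_nbhds" "V \<subseteq> A"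
    using AB(1,3) by (rule sym_nbhds_within)
  have "\<forall>u\<in>V. \<forall>z\<in>B. \<phi> u z \<in> W"
    using subset_trans[OF Sigma_mono AB(5), of V "\<lambda>_. B"] V(2) by auto
  with V(1) AB(2,4) show ?thesis by (rule that)
qed

lemma subflow_orbit_closure:
  assumes x: "x \<in> topspace X"
  shows "subflow G X \<phi> (X closure_of orbit G \<phi> x)" "x \<in> X closure_of orbit G \<phi> x"
proof -
  have orb: "orbit G \<phi> x \<subseteq> topspace X"
    using x element_image by (auto simp: orbit_def)
  have "x \<in> orbit G \<phi> x"
    using act_one[OF x] by (auto simp: orbit_def) (metis one_closed)
  then show x': "x \<in> X closure_of orbit G \<phi> x"
    using closure_of_subset[OF orb] by auto
  have "\<phi> g ` (X closure_of orbit G \<phi> x) \<subseteq> X closure_of orbit G \<phi> x" if g: "g \<in> carrier G" for g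
  proof -
    have "\<phi> g ` (X closure_of orbit G \<phi> x) \<subseteq> X closure_of (\<phi> g ` orbit G \<phi> x)"
      using continuous_act[OF g] continuous_map_image_closure_subset by blast
    also have "\<phi> g ` orbit G \<phi> x \<subseteq> orbit G \<phi> x"
      using composition_rule[OF x g] g by (auto simp: orbit_def) (metis m_closed)
    finally show ?thesis by (meson closure_of_mono order_trans)
  qed
  then show "subflow G X \<phi> (X closure_of orbit G \<phi> x)"
    using x' by (auto simp: subflow_def)
qed

lemma subflow_orbit_closure_subset:
  assumes "subflow G X \<phi> S" "x \<in> S"
  shows "X closure_of orbit G \<phi> x \<subseteq> S"
  using assms by (intro closure_of_minimal) (auto simp: subflow_def orbit_def)

text \<open>Stated for a subgroup \<open>K\<close>, so that it also yields flows of \<open>K\<close>.\<close>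

lemma flow_restrict:
  assumes K: "subgroup K G" and S: "subflow (G\<lparr>carrier := K\<rparr>) X \<phi> S"
  shows "flow (G\<lparr>carrier := K\<rparr>) (subtopology T K) (subtopology X S) (\<lambda>g. restrict (\<phi> g) S)"
proof -
  let ?K = "G\<lparr>carrier := K\<rparr>"
  interpret K: subgroup K G by (rule K)
  have SX: "S \<subseteq> topspace X" and inv: "\<And>k x. k \<in> K \<Longrightarrow> x \<in> S \<Longrightarrow> \<phi> k x \<in> S" and "S \<noteq> {}" and cl: "closedin X S"
    using S closedin_subset by (fastforce simp: subflow_def)+
  have tS: "topspace (subtopology X S) = S" using SX by auto
  have gK: "group ?K" using K.subgroup_is_group[OF is_group] .
  have "group_action ?K S (\<lambda>g. restrict (\<phi> g) S)"
    by (rule group_actionI[OF gK]) (use inv SX composition_rule act_one in auto)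
  moreover have "continuous_map (prod_topology (subtopology T K) (subtopology X S)) (subtopology X S)
      (\<lambda>(g, x). restrict (\<phi> g) S x)"
  proof -
    have "continuous_map (subtopology (prod_topology T X) (K \<times> S)) X (\<lambda>(g, x). \<phi> g x)"
      using flow continuous_map_from_subtopology by (auto simp: flow_def)
    then have "continuous_map (prod_topology (subtopology T K) (subtopology X S)) X (\<lambda>(g, x). \<phi> g x)"
      by (simp add: subtopology_Times)
    then have "continuous_map (prod_topology (subtopology T K) (subtopology X S)) X (\<lambda>(g, x). restrict (\<phi> g) S x)"
      by (rule continuous_map_eq) auto
    then show ?thesis
      using inv by (auto simp: continuous_map_in_subtopology)
  qed
  moreover have "compact_space (subtopology X S)"
    using cl compact_X closedin_compact_space compact_space_subtopology by blast
  ultimately show ?thesis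
    unfolding flow_def tS using \<open>S \<noteq> {}\<close> Hausdorff_X Hausdorff_space_subtopology SX
    by (metis topspace_subtopology_subset null_topspace_iff_trivial)
qed

lemma minimal_flow_subtopology_iff:
  assumes K: "subgroup K G" and S: "subflow (G\<lparr>carrier := K\<rparr>) X \<phi> S"
  shows "minimal_flow (G\<lparr>carrier := K\<rparr>) (subtopology T K) (subtopology X S) (\<lambda>g. restrict (\<phi> g) S) \<longleftrightarrow>
    minimal_subflow (G\<lparr>carrier := K\<rparr>) X \<phi> S"
proof -
  have cl: "closedin X S" using S by (simp add: subflow_def)
  then have tS: "topspace (subtopology X S) = S" using closedin_subset by auto
  have "subflow (G\<lparr>carrier := K\<rparr>) (subtopology X S) (\<lambda>g. restrict (\<phi> g) S) S' \<longleftrightarrow>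
      S' \<subseteq> S \<and> subflow (G\<lparr>carrier := K\<rparr>) X \<phi> S'" for S'
  proof -
    have "restrict (\<phi> g) S ` S' = \<phi> g ` S'" if "S' \<subseteq> S" for g
      using that by (intro image_cong) auto
    moreover have "closedin (subtopology X S) S' \<longleftrightarrow> closedin X S' \<and> S' \<subseteq> S"
      using closedin_closed_subtopology[OF cl] .
    ultimately show ?thesis unfolding subflow_def by metis
  qed
  then show ?thesis
    using flow_restrict[OF assms] S unfolding minimal_flow_def minimal_subflow_def tS by blast
qed

text \<open>Compactness makes the intersection of a chain of subflows a subflow, so Zorn's lemma applies.\<close>

lemma ex_minimal_subflow:
  assumes S: "subflow K X \<phi> S"
  obtains M where "M \<subseteq> S" "minimal_subflow K X \<phi> M"
proof -
  let ?A = "{S'. S' \<subseteq> S \<and> subflow K X \<phi> S'}"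
  \<comment> \<open>Complements turn minimal subflows into maximal sets.\<close>
  have "\<exists>M\<in>uminus ` ?A. \<forall>X\<in>uminus ` ?A. M \<subseteq> X \<longrightarrow> X = M"
  proof (rule subset_Zorn_nonempty)
    show "uminus ` ?A \<noteq> {}" using S by auto
    fix C assume C: "C \<noteq> {}" "subset.chain (uminus ` ?A) C"
    define D where "D = uminus ` C"
    have D: "D \<noteq> {}" "D \<subseteq> ?A" using C by (auto simp: D_def subset_chain_def)
    have chain: "subset.chain UNIV D"
      unfolding subset_chain_def
    proof (intro conjI ballI)
      fix P Q assume "P \<in> D" "Q \<in> D"
      then have "- P \<in> C" "- Q \<in> C" by (auto simp: D_def)
      then have "- P \<subseteq> - Q \<or> - Q \<subseteq> - P" using C(2) unfolding subset_chain_def by blast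
      then show "P \<subseteq> Q \<or> Q \<subseteq> P" by blast
    qed simp
    have closed: "closedin X P" "P \<noteq> {}" if "P \<in> D" for P
      using D(2) that by (auto simp: subflow_def)
    have "\<Inter>\<F> \<noteq> {}" if "finite \<F>" "\<F> \<subseteq> D" for \<F>
    proof (cases "\<F> = {}")
      case False
      then have "\<Inter>\<F> \<in> \<F>"
        using that chain by (intro Inter_in_chain[of \<F> UNIV]) (auto simp: subset_chain_def)
      then show ?thesis using closed(2) that(2) by blast
    qed simp
    then have "\<Inter>D \<noteq> {}"
      using closed(1) by (intro compact_space_fip[THEN iffD1, OF compact_X, rule_format]) simp
    moreover have "closedin X (\<Inter>D)" using D(1,2) by (auto simp: subflow_def intro!: closedin_Inter)
    moreover have "\<phi> g ` \<Inter>D \<subseteq> \<Inter>D" if "g \<in> carrier K" for g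
      using D(2) that by (fastforce simp: subflow_def)
    moreover have "\<Inter>D \<subseteq> S" using D by blast
    ultimately have "\<Inter>D \<in> ?A" by (simp add: subflow_def)
    moreover have "\<Union>C = - \<Inter>D" by (auto simp: D_def)
    ultimately show "\<Union>C \<in> uminus ` ?A" by blast
  qed
  then obtain M where M: "M \<in> ?A" and max: "\<And>S'. S' \<in> ?A \<Longrightarrow> - M \<subseteq> - S' \<Longrightarrow> - S' = - M"
    by (elim bexE imageE) (simp only: ball_simps, blast)
  have "S' = M" if "S' \<subseteq> M" "subflow K X \<phi> S'" for S'
  proof -
    have "S' \<subseteq> S" using that(1) M by auto
    then have "- S' = - M" using that by (intro max) auto
    then show ?thesis by simp
  qed
  then show ?thesis using M by (intro that[of M]) (auto simp: minimal_subflow_def)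
qed

text \<open>In a minimal subflow every orbit is dense, so the orbit closure of any of its points is the subflow itself.\<close>

lemma almost_periodic_points_eq:
  "almost_periodic_points G T X \<phi> = \<Union>{S. minimal_subflow G X \<phi> S}"
proof -
  have "G\<lparr>carrier := carrier G\<rparr> = G" "subtopology T (carrier G) = T"
    using topspace_eq subtopology_topspace[of T] by simp_all
  then have "minimal_flow G T (subtopology X C) (\<lambda>g. restrict (\<phi> g) C) \<longleftrightarrow> minimal_subflow G X \<phi> C"
    if "subflow G X \<phi> C" for C
    using minimal_flow_subtopology_iff[OF subgroup_self, of C] that by simp
  then have "almost_periodic_points G T X \<phi> =
      {x \<in> topspace X. minimal_subflow G X \<phi> (X closure_of orbit G \<phi> x)}"
    using subflow_orbit_closure(1) by (auto simp: almost_periodic_points_def Let_def)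
  also have "\<dots> = \<Union>{S. minimal_subflow G X \<phi> S}"
  proof (intro equalityI subsetI)
    fix x assume "x \<in> {x \<in> topspace X. minimal_subflow G X \<phi> (X closure_of orbit G \<phi> x)}"
    then show "x \<in> \<Union>{S. minimal_subflow G X \<phi> S}" using subflow_orbit_closure(2) by blast
  next
    fix x assume "x \<in> \<Union>{S. minimal_subflow G X \<phi> S}"
    then obtain S where S: "minimal_subflow G X \<phi> S" "x \<in> S" by blast
    then have x: "x \<in> topspace X" and "subflow G X \<phi> S"
      using closedin_subset by (fastforce simp: minimal_subflow_def subflow_def)+
    then have "X closure_of orbit G \<phi> x = S"
      using subflow_orbit_closure(1)[OF x] subflow_orbit_closure_subset S
      unfolding minimal_subflow_def by blast
    then show "x \<in> {x \<in> topspace X. minimal_subflow G X \<phi> (X closure_of orbit G \<phi> x)}"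
      using S x by simp
  qed
  finally show ?thesis .
qed

text \<open>A minimal \<open>K\<close>-subflow of \<open>S\<close> is a quotient of the one-point universal minimal flow of \<open>K\<close>, so it
  is a single point.\<close>

lemma extremely_amenable_fixed_point:
  assumes K: "subgroup K G" and ea: "extremely_amenable (G\<lparr>carrier := K\<rparr>) (subtopology T K)"
    and S: "S \<noteq> {}" "closedin X S" "\<And>k x. k \<in> K \<Longrightarrow> x \<in> S \<Longrightarrow> \<phi> k x \<in> S"
  obtains x where "x \<in> S" "\<forall>k\<in>K. \<phi> k x = x"
proof -
  have "subflow (G\<lparr>carrier := K\<rparr>) X \<phi> S" using S by (auto simp: subflow_def)
  then obtain M where M: "M \<subseteq> S" "minimal_subflow (G\<lparr>carrier := K\<rparr>) X \<phi> M"
    by (rule ex_minimal_subflow)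
  then have sub: "subflow (G\<lparr>carrier := K\<rparr>) X \<phi> M" by (simp add: minimal_subflow_def)
  have tK: "topspace (subtopology T K) = carrier (G\<lparr>carrier := K\<rparr>)"
    using subgroup.subset[OF K] topspace_eq by auto
  have "is_singleton (topspace (subtopology X M))"
    using extremely_amenable_minimal_flow_singleton[OF tK ea] minimal_flow_subtopology_iff[OF K sub] M(2)
    by blast
  moreover have "M \<subseteq> topspace X" using sub closedin_subset by (auto simp: subflow_def)
  ultimately obtain x where "M = {x}" by (auto simp: is_singleton_def inf.absorb2)
  then show ?thesis using sub M(1) by (intro that[of x]) (auto simp: subflow_def)
qed

lemma flow_map_image_subflow:
  assumes Y: "flow G T Y \<psi>" and f: "flow_map G X \<phi> Y \<psi> f" and S: "subflow G X \<phi> S"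
  shows "subflow G Y \<psi> (f ` S)"
proof -
  have SX: "S \<subseteq> topspace X" "closedin X S" "S \<noteq> {}" using S closedin_subset by (auto simp: subflow_def)
  have "compactin Y (f ` S)"
    using f unfolding flow_map_def by (intro image_compactin[OF closedin_compact_space[OF compact_X SX(2)]]) blast
  then have "closedin Y (f ` S)"
    using Y compactin_imp_closedin by (auto simp: flow_def)
  moreover have "\<psi> g (f x) \<in> f ` S" if "g \<in> carrier G" "x \<in> S" for g x
  proof -
    have "\<psi> g (f x) = f (\<phi> g x)" using f that SX(1) by (auto simp: flow_map_def)
    then show ?thesis using S that by (auto simp: subflow_def)
  qed
  ultimately show ?thesis using SX(3) by (auto simp: subflow_def)
qed

text \<open>A subflow \<open>S'\<close> of the image has a preimage in \<open>S\<close> that is a subflow, hence all of \<open>S\<close>.\<close>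

lemma flow_map_image_minimal_subflow:
  assumes Y: "flow G T Y \<psi>" and f: "flow_map G X \<phi> Y \<psi> f" and S: "minimal_subflow G X \<phi> S"
  shows "minimal_subflow G Y \<psi> (f ` S)"
  unfolding minimal_subflow_def
proof (intro conjI allI impI)
  have sub: "subflow G X \<phi> S" using S by (simp add: minimal_subflow_def)
  then show "subflow G Y \<psi> (f ` S)" using flow_map_image_subflow[OF Y f] by simp
  have SX: "S \<subseteq> topspace X" "closedin X S" using sub closedin_subset by (auto simp: subflow_def)
  fix S' assume S': "S' \<subseteq> f ` S" "subflow G Y \<psi> S'"
  let ?P = "S \<inter> {x \<in> topspace X. f x \<in> S'}"
  have "closedin X {x \<in> topspace X. f x \<in> S'}"
    using f S'(2) closedin_continuous_map_preimage unfolding flow_map_def subflow_def by blast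
  then have "closedin X ?P" by (rule closedin_Int[OF SX(2)])
  moreover obtain y where "y \<in> S'" using S'(2) by (auto simp: subflow_def)
  then obtain x where "x \<in> S" "f x \<in> S'" using S'(1) by blast
  then have "?P \<noteq> {}" using SX(1) by blast
  moreover have "\<phi> g x \<in> ?P" if "g \<in> carrier G" "x \<in> ?P" for g x
  proof -
    have "f (\<phi> g x) = \<psi> g (f x)" using f that by (auto simp: flow_map_def)
    moreover have "\<phi> g x \<in> S" "\<psi> g (f x) \<in> S'"
      using sub S'(2) that by (simp_all add: subflow_def image_subset_iff)
    ultimately show ?thesis using SX(1) by auto
  qed
  ultimately have "subflow G X \<phi> ?P" unfolding subflow_def by (simp add: image_subset_iff)
  then have "?P = S" using S unfolding minimal_subflow_def by blast
  then show "S' = f ` S" using S'(1) by blast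
qed

end

section \<open>The uniformity of the coset space\<close>

locale topological_subgroup = topological_group G T + subgroup H G for G (structure) and T and H
begin

abbreviation "\<U> \<equiv> coset_uniformity G T H"
abbreviation "Y \<equiv> coset_completion G T H"
abbreviation "act \<equiv> coset_completion_action G T H"

lemma coset_subset: "C \<in> lcosets H \<Longrightarrow> C \<subseteq> carrier G"
  using lcosets_subset_PowG[OF subgroup_axioms] by auto

lemma H_coset: "H \<in> lcosets H"
  using lcos_mult_one[OF subset] by (force simp: LCOSETS_def)

lemma coset_mult: "g \<in> carrier G \<Longrightarrow> h \<in> carrier G \<Longrightarrow> C \<in> lcosets H \<Longrightarrow> g <# (h <# C) = (g \<otimes> h) <# C"
  using lcos_m_assoc[OF coset_subset] by simp

lemma coset_one: "C \<in> lcosets H \<Longrightarrow> \<one> <# C = C"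
  using lcos_mult_one[OF coset_subset] by simp

lemma coset_closed: "g \<in> carrier G \<Longrightarrow> C \<in> lcosets H \<Longrightarrow> g <# C \<in> lcosets H"
  using lcos_m_assoc[OF subset] by (auto simp: LCOSETS_def)

lemma coset_inv: "g \<in> carrier G \<Longrightarrow> C \<in> lcosets H \<Longrightarrow> inv g <# (g <# C) = C"
  "g \<in> carrier G \<Longrightarrow> C \<in> lcosets H \<Longrightarrow> g <# (inv g <# C) = C"
  using coset_mult coset_one by simp_all

text \<open>This puts the entourages into the form used throughout: two cosets are close if a small element
  of the group moves one to the other.\<close>

lemma cosets_related_iff:
  assumes U: "U \<subseteq> carrier G" and g: "g \<in> carrier G" and k: "k \<in> carrier G"
  shows "(g <# H #> inv k) \<inter> U \<noteq> {} \<longleftrightarrow> (\<exists>u\<in>U. g <# H = u <# (k <# H))"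
proof
  assume "(g <# H #> inv k) \<inter> U \<noteq> {}"
  then obtain h where h: "h \<in> H" "g \<otimes> h \<otimes> inv k \<in> U"
    by (auto simp: r_coset_def l_coset_def)
  then have hG: "h \<in> carrier G" by auto
  have "(g \<otimes> h \<otimes> inv k) <# (k <# H) = (g \<otimes> h \<otimes> inv k \<otimes> k) <# H"
    using g k hG lcos_m_assoc[OF subset] by simp
  also have "\<dots> = g <# (h <# H)"
    using g k hG lcos_m_assoc[OF subset] by (simp add: m_assoc)
  also have "h <# H = H" using coset_join3[OF hG subgroup_axioms h(1)] .
  finally show "\<exists>u\<in>U. g <# H = u <# (k <# H)" using h(2) by metis
next
  assume "\<exists>u\<in>U. g <# H = u <# (k <# H)"
  then obtain u where u: "u \<in> U" "g <# H = (u \<otimes> k) <# H"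
    using k U lcos_m_assoc[OF subset] by (metis subsetD)
  have "g \<in> g <# H" using lcos_self[OF g subgroup_axioms] .
  then obtain h where h: "h \<in> H" "g = u \<otimes> k \<otimes> h"
    unfolding u(2) by (auto simp: l_coset_def)
  have "u \<in> carrier G" "h \<in> carrier G" using u U h by auto
  then have "u = g \<otimes> inv h \<otimes> inv k"
    using h(2) k by (simp add: m_assoc)
  moreover have "g \<otimes> inv h \<otimes> inv k \<in> g <# H #> inv k"
    using h(1) by (auto simp: r_coset_def l_coset_def)
  ultimately show "(g <# H #> inv k) \<inter> U \<noteq> {}" using u(1) by blast
qed

lemma eventually_coset_uniformity:
  "eventually P \<U> \<longleftrightarrow> (\<exists>U\<in>sym_nbhds. \<forall>u\<in>U. \<forall>C\<in>lcosets H. P (u <# C, C))"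
proof -
  let ?E = "\<lambda>U. {(u <# C, C) | u C. u \<in> U \<and> C \<in> lcosets H}"
  have "{(g <# H, k <# H) | g k. g \<in> carrier G \<and> k \<in> carrier G \<and> (g <# H #> inv k) \<inter> U \<noteq> {}} = ?E U"
    (is "?L = _") if "U \<in> sym_nbhds" for U
  proof (intro equalityI subsetI)
    have U: "U \<subseteq> carrier G" using sym_nbhds_carrier[OF that] .
    fix p
    { assume "p \<in> ?L"
      then obtain g k where p: "p = (g <# H, k <# H)" and gk: "g \<in> carrier G" "k \<in> carrier G"
        and meet: "(g <# H #> inv k) \<inter> U \<noteq> {}"
        unfolding mem_Collect_eq by (elim exE conjE)
      obtain u where "u \<in> U" "g <# H = u <# (k <# H)"
        using cosets_related_iff[THEN iffD1, OF U gk meet] by (rule bexE)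
      moreover have "k <# H \<in> lcosets H" using gk(2) by (auto simp: LCOSETS_def)
      ultimately show "p \<in> ?E U" using p by auto }
    { assume "p \<in> ?E U"
      then obtain u k where p: "p = (u <# (k <# H), k <# H)" "u \<in> U" "k \<in> carrier G"
        by (auto simp: LCOSETS_def)
      then have uk: "u \<otimes> k \<in> carrier G" "u <# (k <# H) = (u \<otimes> k) <# H"
        using U lcos_m_assoc[OF subset] by auto
      then have "((u \<otimes> k) <# H #> inv k) \<inter> U \<noteq> {}"
        using p cosets_related_iff[OF U uk(1) p(3)] by metis
      then show "p \<in> ?L" using p(1,3) uk by blast }
  qed
  then have eq: "\<U> = (INF U\<in>sym_nbhds. principal (?E U))"
    unfolding coset_uniformity_def sym_nbhds_def by (intro INF_cong refl) (simp add: sym_nbhds_def)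
  show ?thesis
    unfolding eq
  proof (subst eventually_INF_base)
    show "sym_nbhds \<noteq> {}" using sym_nbhds_carrier_mem by blast
    fix U V assume "U \<in> sym_nbhds" "V \<in> sym_nbhds"
    then have "U \<inter> V \<in> sym_nbhds" by (rule sym_nbhds_Int)
    moreover have "?E (U \<inter> V) \<subseteq> ?E U \<inter> ?E V" by blast
    then have "principal (?E (U \<inter> V)) \<le> inf (principal (?E U)) (principal (?E V))" by simp
    ultimately show "\<exists>W\<in>sym_nbhds. principal (?E W) \<le> inf (principal (?E U)) (principal (?E V))" by blast
  qed (auto simp: eventually_principal)
qed

text \<open>The condition says that \<open>A \<times> A\<close> lies in the entourage given by \<open>U\<close>.\<close>

definition small :: "'a set \<Rightarrow> 'a set set \<Rightarrow> bool"
  where "small U A \<longleftrightarrow> A \<subseteq> lcosets H \<and> (\<forall>C\<in>A. \<forall>D\<in>A. \<exists>u\<in>U. D = u <# C)"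

lemma small_translate:
  assumes "small U A" "C \<in> A" "D \<in> A"
  obtains u where "u \<in> U" "D = u <# C"
  using assms(1)[unfolded small_def, THEN conjunct2, rule_format, OF assms(2,3)] by (rule bexE)

lemma small_cosets: "small U A \<Longrightarrow> C \<in> A \<Longrightarrow> C \<in> lcosets H"
  unfolding small_def by (elim conjE) (rule subsetD)

abbreviation "cauchy \<equiv> cauchy_filter_on (lcosets H) \<U>"

lemma cauchy_iff:
  "cauchy F \<longleftrightarrow> F \<noteq> bot \<and> (\<forall>\<^sub>F C in F. C \<in> lcosets H) \<and> (\<forall>U\<in>sym_nbhds. \<exists>A. small U A \<and> (\<forall>\<^sub>F C in F. C \<in> A))"
proof -
  have "F \<times>\<^sub>F F \<le> \<U> \<longleftrightarrow> (\<forall>U\<in>sym_nbhds. \<exists>A. small U A \<and> (\<forall>\<^sub>F C in F. C \<in> A))"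
    if F: "\<forall>\<^sub>F C in F. C \<in> lcosets H"
  proof
    assume le: "F \<times>\<^sub>F F \<le> \<U>"
    show "\<forall>U\<in>sym_nbhds. \<exists>A. small U A \<and> (\<forall>\<^sub>F C in F. C \<in> A)"
    proof
      fix U assume "U \<in> sym_nbhds"
      then have "\<forall>\<^sub>F (D, C) in \<U>. \<exists>u\<in>U. D = u <# C"
        unfolding eventually_coset_uniformity by auto
      then have "\<forall>\<^sub>F (D, C) in F \<times>\<^sub>F F. \<exists>u\<in>U. D = u <# C"
        using le by (simp add: filter_leD)
      then obtain Q where "eventually Q F" "\<And>C D. Q C \<Longrightarrow> Q D \<Longrightarrow> \<exists>u\<in>U. D = u <# C"
        unfolding eventually_prod_same by auto
      then show "\<exists>A. small U A \<and> (\<forall>\<^sub>F C in F. C \<in> A)"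
        using F by (intro exI[of _ "{C \<in> lcosets H. Q C}"]) (auto simp: small_def eventually_conj_iff)
    qed
  next
    assume small: "\<forall>U\<in>sym_nbhds. \<exists>A. small U A \<and> (\<forall>\<^sub>F C in F. C \<in> A)"
    show "F \<times>\<^sub>F F \<le> \<U>"
      unfolding le_filter_def
    proof (intro allI impI)
      fix P assume "eventually P \<U>"
      then obtain U where U: "U \<in> sym_nbhds" "\<forall>u\<in>U. \<forall>C\<in>lcosets H. P (u <# C, C)"
        unfolding eventually_coset_uniformity by blast
      then obtain A where A: "small U A" "\<forall>\<^sub>F C in F. C \<in> A" using small by blast
      have "P (C, D)" if CD: "C \<in> A" "D \<in> A" for C D
      proof -
        obtain u where "u \<in> U" "C = u <# D" by (rule small_translate[OF A(1) CD(2,1)])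
        then show ?thesis using U(2) small_cosets[OF A(1) CD(2)] by simp
      qed
      then show "eventually P (F \<times>\<^sub>F F)" using A(2) unfolding eventually_prod_same by blast
    qed
  qed
  then show ?thesis
    unfolding cauchy_filter_on_def le_principal by blast
qed

lemma cauchyD:
  assumes "cauchy F"
  shows "F \<noteq> bot" "\<forall>\<^sub>F C in F. C \<in> lcosets H"
  using assms by (auto simp: cauchy_iff)

lemma cauchy_small:
  assumes "cauchy F" "U \<in> sym_nbhds"
  obtains A where "small U A" "\<forall>\<^sub>F C in F. C \<in> A"
  using assms by (auto simp: cauchy_iff)

lemma cauchy_ex:
  assumes "cauchy F" "\<forall>\<^sub>F C in F. C \<in> A" "\<forall>\<^sub>F C in F. C \<in> B"
  obtains C where "C \<in> A" "C \<in> B" "C \<in> lcosets H"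
  using eventually_happens'[OF cauchyD(1)[OF assms(1)] eventually_conj[OF eventually_conj[OF assms(2,3)] cauchyD(2)[OF assms(1)]]]
  by blast

text \<open>The filter of all uniform neighbourhoods \<open>U A\<close> of the members \<open>A\<close> of \<open>F\<close>.  For a Cauchy filter
  \<open>F\<close> it is the minimal Cauchy filter contained in \<open>F\<close> (as a family of sets), that is, the point of the
  completion to which \<open>F\<close> converges.\<close>

definition rounding :: "'a set filter \<Rightarrow> 'a set filter"
  where "rounding F = filtermap (\<lambda>(u, C). u <# C) (nhdsin T \<one> \<times>\<^sub>F F)"

lemma eventually_rounding:
  "eventually P (rounding F) \<longleftrightarrow>
    (\<exists>U\<in>sym_nbhds. \<exists>A. (\<forall>\<^sub>F C in F. C \<in> A) \<and> (\<forall>u\<in>U. \<forall>C\<in>A. P (u <# C)))"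
proof
  assume "eventually P (rounding F)"
  then obtain Q R where Q: "eventually Q (nhdsin T \<one>)" and R: "eventually R F"
    and P: "\<And>u C. Q u \<Longrightarrow> R C \<Longrightarrow> P (u <# C)"
    by (auto simp: rounding_def eventually_filtermap eventually_prod_filter)
  obtain W where "openin T W" "\<one> \<in> W" and W: "\<forall>u\<in>W. Q u"
    using Q topspace_eq by (auto simp: eventually_nhdsin)
  then obtain U where "U \<in> sym_nbhds" "U \<subseteq> W" by (auto intro: sym_nbhds_within)
  then show "\<exists>U\<in>sym_nbhds. \<exists>A. (\<forall>\<^sub>F C in F. C \<in> A) \<and> (\<forall>u\<in>U. \<forall>C\<in>A. P (u <# C))"
    using W R P by (intro bexI[of _ U] exI[of _ "Collect R"]) auto
next
  assume "\<exists>U\<in>sym_nbhds. \<exists>A. (\<forall>\<^sub>F C in F. C \<in> A) \<and> (\<forall>u\<in>U. \<forall>C\<in>A. P (u <# C))"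
  then obtain U A where UA: "U \<in> sym_nbhds" "\<forall>\<^sub>F C in F. C \<in> A" "\<forall>u\<in>U. \<forall>C\<in>A. P (u <# C)" by blast
  have "\<forall>\<^sub>F u in nhdsin T \<one>. u \<in> U"
    using sym_nbhds_openin[OF UA(1)] sym_nbhds_one[OF UA(1)] unfolding eventually_nhdsin by blast
  then show "eventually P (rounding F)"
    using UA(2,3) unfolding rounding_def eventually_filtermap eventually_prod_filter by fastforce
qed

lemma le_rounding:
  assumes "\<forall>\<^sub>F C in F. C \<in> lcosets H"
  shows "F \<le> rounding F"
  unfolding le_filter_def
proof (intro allI impI)
  fix P assume "eventually P (rounding F)"
  then obtain U A where UA: "U \<in> sym_nbhds" "\<forall>\<^sub>F C in F. C \<in> A" "\<forall>u\<in>U. \<forall>C\<in>A. P (u <# C)"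
    unfolding eventually_rounding by blast
  show "eventually P F"
    using eventually_conj[OF UA(2) assms]
    by eventually_elim (use UA(3) sym_nbhds_one[OF UA(1)] coset_one in fastforce)
qed

text \<open>A \<open>U\<close>-small member of \<open>F'\<close> meets every member \<open>A\<close> of \<open>F\<close>, so it lies inside \<open>U A\<close>.\<close>

lemma rounding_greatest:
  assumes F: "cauchy F" and F': "cauchy F'" and le: "F \<le> F'"
  shows "F' \<le> rounding F"
  unfolding le_filter_def
proof (intro allI impI)
  fix P assume "eventually P (rounding F)"
  then obtain U A where UA: "U \<in> sym_nbhds" "\<forall>\<^sub>F C in F. C \<in> A" "\<forall>u\<in>U. \<forall>C\<in>A. P (u <# C)"
    unfolding eventually_rounding by blast
  obtain B where B: "small U B" "\<forall>\<^sub>F C in F'. C \<in> B"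
    by (rule cauchy_small[OF F' UA(1)])
  obtain C where C: "C \<in> A" "C \<in> B" "C \<in> lcosets H"
    by (rule cauchy_ex[OF F UA(2) filter_leD[OF le B(2)]])
  have "P D" if D: "D \<in> B" for D
  proof -
    obtain u where "u \<in> U" "D = u <# C" by (rule small_translate[OF B(1) C(2) D])
    then show ?thesis using UA(3) C(1) by simp
  qed
  then show "eventually P F'" using B(2) by (metis (mono_tags, lifting) eventually_mono)
qed

text \<open>If \<open>A\<close> is small of order \<open>W\<close>, then \<open>W A\<close> is small of order \<open>W W W\<close>.\<close>

lemma cauchy_rounding:
  assumes F: "cauchy F"
  shows "cauchy (rounding F)"
  unfolding cauchy_iff
proof (intro conjI ballI)
  have le: "F \<le> rounding F" using le_rounding cauchyD(2)[OF F] .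
  then show "rounding F \<noteq> bot" using cauchyD(1)[OF F] by (metis bot_unique)
  show "\<forall>\<^sub>F C in rounding F. C \<in> lcosets H"
    unfolding eventually_rounding
    using sym_nbhds_carrier_mem cauchyD(2)[OF F] coset_closed by blast
  fix U assume U: "U \<in> sym_nbhds"
  obtain V where V: "V \<in> sym_nbhds" "\<forall>v\<in>V. \<forall>w\<in>V. v \<otimes> w \<in> U"
    by (rule sym_nbhds_square[OF U])
  obtain W where W: "W \<in> sym_nbhds" "\<forall>v\<in>W. \<forall>w\<in>W. v \<otimes> w \<in> V"
    by (rule sym_nbhds_square[OF V(1)])
  have WG: "W \<subseteq> carrier G" using sym_nbhds_carrier[OF W(1)] .
  have WV: "w \<in> V" if "w \<in> W" for w
    using W(2)[rule_format, OF that sym_nbhds_one[OF W(1)]] that WG by auto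
  obtain A where A: "small W A" "\<forall>\<^sub>F C in F. C \<in> A"
    by (rule cauchy_small[OF F W(1)])
  define B where "B = {w <# C | w C. w \<in> W \<and> C \<in> A}"
  have "\<exists>u\<in>U. D' = u <# D" if "D \<in> B" "D' \<in> B" for D D'
  proof -
    obtain v w C C' where 1: "D = v <# C" "D' = w <# C'" "v \<in> W" "w \<in> W" "C \<in> A" "C' \<in> A"
      using \<open>D \<in> B\<close> \<open>D' \<in> B\<close> unfolding B_def by blast
    obtain x where x: "x \<in> W" "C' = x <# C" by (rule small_translate[OF A(1) 1(5,6)])
    have C: "C \<in> lcosets H" by (rule small_cosets[OF A(1) 1(5)])
    have G: "v \<in> carrier G" "w \<in> carrier G" "x \<in> carrier G" using 1 x(1) WG by auto
    have "inv v \<in> V" using WV sym_nbhds_inv[OF W(1) 1(3)] by simp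
    then have "w \<otimes> x \<otimes> inv v \<in> U" using V(2) W(2) 1(4) x(1) by simp
    moreover have "D' = (w \<otimes> x \<otimes> inv v) <# D"
      unfolding 1(1,2) x(2)
      using G C coset_closed coset_inv(1)[OF G(1) C]
        coset_mult[of "w \<otimes> x" "inv v" "v <# C"] coset_mult[of w x C] by simp
    ultimately show ?thesis by blast
  qed
  moreover have "B \<subseteq> lcosets H"
    using A(1) WG coset_closed by (auto simp: B_def small_def)
  ultimately have "small U B" by (simp add: small_def)
  moreover have "\<forall>\<^sub>F C in rounding F. C \<in> B"
    unfolding eventually_rounding using W(1) A(2) by (auto simp: B_def)
  ultimately show "\<exists>A. small U A \<and> (\<forall>\<^sub>F C in rounding F. C \<in> A)" by blast
qed


section \<open>The completion\<close>

text \<open>The points of the completion are the round Cauchy filters.  Roundness is what makes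
  \<open>{p. A \<in> p}\<close> open for every \<open>A\<close>; see \<open>openin_basic\<close>.\<close>

lemma completion_point_iff: "p \<in> topspace Y \<longleftrightarrow> cauchy p \<and> rounding p = p"
  unfolding topspace_coset_completion completion_points_def
proof (intro iffI CollectI conjI)
  assume "p \<in> {F. cauchy F \<and> (\<forall>F'. cauchy F' \<and> F \<le> F' \<longrightarrow> F' = F)}"
  then show "cauchy p" "rounding p = p"
    using cauchy_rounding le_rounding[OF cauchyD(2)] by auto
next
  assume p: "cauchy p \<and> rounding p = p"
  then show "cauchy p" by simp
  show "\<forall>F'. cauchy F' \<and> p \<le> F' \<longrightarrow> F' = p"
    using rounding_greatest[of p] p by (metis order_antisym)
qed

lemma completion_point_cauchy: "p \<in> topspace Y \<Longrightarrow> cauchy p"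
  by (simp add: completion_point_iff)

lemma completion_point_maximal:
  assumes "p \<in> topspace Y" "cauchy F" "p \<le> F"
  shows "F = p"
  using assms rounding_greatest[of p F] by (auto simp: completion_point_iff)

lemma rounding_completion_point:
  assumes F: "cauchy F"
  shows "rounding F \<in> topspace Y"
  unfolding completion_point_iff
proof
  show c: "cauchy (rounding F)" using cauchy_rounding[OF F] .
  have "F \<le> rounding F" using le_rounding[OF cauchyD(2)[OF F]] .
  also have le: "rounding F \<le> rounding (rounding F)" using le_rounding[OF cauchyD(2)[OF c]] .
  finally have "rounding (rounding F) \<le> rounding F"
    using rounding_greatest[OF F cauchy_rounding[OF c]] by simp
  then show "rounding (rounding F) = rounding F" using le by (rule order_antisym)
qed

definition basic :: "'a set set \<Rightarrow> 'a set filter set"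
  where "basic A = {p \<in> topspace Y. \<forall>\<^sub>F C in p. C \<in> A}"

lemma basic_Int: "basic (A \<inter> B) = basic A \<inter> basic B"
  by (auto simp: basic_def eventually_conj_iff)

lemma eventually_completion_uniformity:
  "eventually P (completion_uniformity (lcosets H) \<U>) \<longleftrightarrow>
    (\<exists>U\<in>sym_nbhds. \<forall>A p q. small U A \<longrightarrow> p \<in> basic A \<longrightarrow> q \<in> basic A \<longrightarrow> P (p, q))"
proof -
  let ?N = "\<lambda>E. {(p, q). p \<in> topspace Y \<and> q \<in> topspace Y \<and>
     (\<exists>A. A \<times> A \<subseteq> E \<and> (\<forall>\<^sub>F C in p. C \<in> A) \<and> (\<forall>\<^sub>F C in q. C \<in> A))}"
  let ?\<E> = "{E. \<forall>\<^sub>F x in \<U>. x \<in> E}"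
  have "eventually P (completion_uniformity (lcosets H) \<U>) \<longleftrightarrow> (\<exists>E\<in>?\<E>. eventually P (principal (?N E)))"
    unfolding completion_uniformity_def topspace_coset_completion
  proof (rule eventually_INF_base)
    show "?\<E> \<noteq> {}" by (auto intro: exI[of _ UNIV])
    fix D E assume DE: "D \<in> ?\<E>" "E \<in> ?\<E>"
    let ?M = "\<lambda>E. {(F, F'). F \<in> completion_points (lcosets H) \<U> \<and> F' \<in> completion_points (lcosets H) \<U> \<and>
         (\<exists>A. A \<times> A \<subseteq> E \<and> (\<forall>\<^sub>F x in F. x \<in> A) \<and> (\<forall>\<^sub>F x in F'. x \<in> A))}"
    show "\<exists>E'\<in>?\<E>. principal (?M E') \<le> inf (principal (?M D)) (principal (?M E))"
    proof (rule bexI[of _ "D \<inter> E"])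
      show "D \<inter> E \<in> ?\<E>" using DE by (simp add: eventually_conj_iff)
      have "?M (D \<inter> E) \<subseteq> ?M D \<inter> ?M E" by blast
      then show "principal (?M (D \<inter> E)) \<le> inf (principal (?M D)) (principal (?M E))" by simp
    qed
  qed
  also have "\<dots> \<longleftrightarrow> (\<exists>E\<in>?\<E>. \<forall>A p q. A \<times> A \<subseteq> E \<longrightarrow> p \<in> basic A \<longrightarrow> q \<in> basic A \<longrightarrow> P (p, q))"
    unfolding eventually_principal basic_def by blast
  also have "\<dots> \<longleftrightarrow> (\<exists>U\<in>sym_nbhds. \<forall>A p q. small U A \<longrightarrow> p \<in> basic A \<longrightarrow> q \<in> basic A \<longrightarrow> P (p, q))"
  proof (intro iffI; elim bexE)
    fix E assume "E \<in> ?\<E>" and E: "\<forall>A p q. A \<times> A \<subseteq> E \<longrightarrow> p \<in> basic A \<longrightarrow> q \<in> basic A \<longrightarrow> P (p, q)"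
    then obtain U where U: "U \<in> sym_nbhds" "\<forall>u\<in>U. \<forall>C\<in>lcosets H. (u <# C, C) \<in> E"
      unfolding eventually_coset_uniformity by blast
    have "A \<times> A \<subseteq> E" if A: "small U A" for A
    proof (rule subsetI, elim SigmaE)
      fix x C D assume "x = (C, D)" "C \<in> A" "D \<in> A"
      moreover obtain u where "u \<in> U" "C = u <# D"
        by (rule small_translate[OF A \<open>D \<in> A\<close> \<open>C \<in> A\<close>])
      moreover have "D \<in> lcosets H" by (rule small_cosets[OF A \<open>D \<in> A\<close>])
      ultimately show "x \<in> E" using U(2) by simp
    qed
    then show "\<exists>U\<in>sym_nbhds. \<forall>A p q. small U A \<longrightarrow> p \<in> basic A \<longrightarrow> q \<in> basic A \<longrightarrow> P (p, q)"
      using U(1) E by meson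
  next
    fix U assume U: "U \<in> sym_nbhds" and P: "\<forall>A p q. small U A \<longrightarrow> p \<in> basic A \<longrightarrow> q \<in> basic A \<longrightarrow> P (p, q)"
    let ?E = "{(u <# C, C) | u C. u \<in> U \<and> C \<in> lcosets H}"
    have "?E \<in> ?\<E>" using U by (auto simp: eventually_coset_uniformity)
    moreover have "small U A" if A: "A \<times> A \<subseteq> ?E" for A
    proof -
      have "D \<in> lcosets H" "\<exists>u\<in>U. D = u <# C" if "C \<in> A" "D \<in> A" for C D
        using subsetD[OF A, of "(D, C)"] subsetD[OF A, of "(D, D)"] that by auto
      then show ?thesis unfolding small_def by blast
    qed
    ultimately show "\<exists>E\<in>?\<E>. \<forall>A p q. A \<times> A \<subseteq> E \<longrightarrow> p \<in> basic A \<longrightarrow> q \<in> basic A \<longrightarrow> P (p, q)"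
      using P by meson
  qed
  finally show ?thesis .
qed

text \<open>The sets \<open>basic A\<close> form a base of the topology.  That \<open>basic A\<close> is a neighbourhood of each of its
  points \<open>p\<close> is roundness: \<open>A\<close> contains some \<open>U B\<close> with \<open>B\<close> in \<open>p\<close>, and a \<open>U\<close>-small set
  that \<open>p\<close> shares with \<open>q\<close> meets \<open>B\<close>, so it lies in \<open>A\<close>.\<close>

lemma openin_completion_iff:
  "openin Y V \<longleftrightarrow> V \<subseteq> topspace Y \<and> (\<forall>p\<in>V. \<exists>A. p \<in> basic A \<and> basic A \<subseteq> V)"
proof -
  have "(\<forall>\<^sub>F (p', q) in completion_uniformity (lcosets H) \<U>. p' = p \<longrightarrow> q \<in> V) \<longleftrightarrow>
      (\<exists>A. p \<in> basic A \<and> basic A \<subseteq> V)" if p: "p \<in> topspace Y" for p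
  proof
    assume "\<forall>\<^sub>F (p', q) in completion_uniformity (lcosets H) \<U>. p' = p \<longrightarrow> q \<in> V"
    then obtain U where U: "U \<in> sym_nbhds" "\<And>A q. small U A \<Longrightarrow> p \<in> basic A \<Longrightarrow> q \<in> basic A \<Longrightarrow> q \<in> V"
      unfolding eventually_completion_uniformity by auto
    obtain A where "small U A" "\<forall>\<^sub>F C in p. C \<in> A"
      by (rule cauchy_small[OF completion_point_cauchy[OF p] U(1)])
    then show "\<exists>A. p \<in> basic A \<and> basic A \<subseteq> V"
      using U(2) p by (auto simp: basic_def)
  next
    assume "\<exists>A. p \<in> basic A \<and> basic A \<subseteq> V"
    then obtain A where A: "p \<in> basic A" "basic A \<subseteq> V" by blast
    have "\<forall>\<^sub>F C in rounding p. C \<in> A" using A(1) p by (simp add: basic_def completion_point_iff)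
    then obtain U B where UB: "U \<in> sym_nbhds" "\<forall>\<^sub>F C in p. C \<in> B" "\<forall>u\<in>U. \<forall>C\<in>B. u <# C \<in> A"
      unfolding eventually_rounding by blast
    have "q \<in> V" if S: "small U S" "p \<in> basic S" "q \<in> basic S" for S q
    proof -
      have "\<forall>\<^sub>F C in p. C \<in> S" using S(2) by (simp add: basic_def)
      then obtain C where C: "C \<in> B" "C \<in> S" "C \<in> lcosets H"
        by (rule cauchy_ex[OF completion_point_cauchy[OF p] UB(2)])
      have "D \<in> A" if D: "D \<in> S" for D
      proof -
        obtain u where "u \<in> U" "D = u <# C" by (rule small_translate[OF S(1) C(2) D])
        then show ?thesis using UB(3) C(1) by simp
      qed
      then have "q \<in> basic A" using S(3) by (auto simp: basic_def elim!: eventually_mono)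
      then show ?thesis using A(2) by blast
    qed
    then show "\<forall>\<^sub>F (p', q) in completion_uniformity (lcosets H) \<U>. p' = p \<longrightarrow> q \<in> V"
      unfolding eventually_completion_uniformity using UB(1) by blast
  qed
  then show ?thesis
    unfolding openin_uniform_topology[of "completion_points (lcosets H) \<U>" "completion_uniformity (lcosets H) \<U>" V,
        folded completion_topology_def, folded coset_completion_def, folded topspace_coset_completion]
    by blast
qed

lemma openin_basic: "openin Y (basic A)"
  unfolding openin_completion_iff by (auto simp: basic_def)

text \<open>If every member of \<open>p\<close> meets every member of \<open>q\<close>, then \<open>sup p q\<close> is a Cauchy filter, since the union
  of two small sets that meet is small.  By minimality it equals both \<open>p\<close> and \<open>q\<close>.\<close>

lemma Hausdorff_completion: "Hausdorff_space Y"
  unfolding Hausdorff_space_def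
proof (intro allI impI)
  fix p q assume pq: "p \<in> topspace Y \<and> q \<in> topspace Y \<and> p \<noteq> q"
  then have p: "cauchy p" and q: "cauchy q" using completion_point_cauchy by auto
  have "\<exists>A B. p \<in> basic A \<and> q \<in> basic B \<and> A \<inter> B = {}"
  proof (rule ccontr)
    assume meet: "\<not> ?thesis"
    have "cauchy (sup p q)"
      unfolding cauchy_iff
    proof (intro conjI ballI)
      show "sup p q \<noteq> bot" using cauchyD(1)[OF p] by simp
      show "\<forall>\<^sub>F C in sup p q. C \<in> lcosets H"
        using cauchyD(2) p q by (simp add: eventually_sup)
      fix U assume U: "U \<in> sym_nbhds"
      obtain V where V: "V \<in> sym_nbhds" "\<forall>v\<in>V. \<forall>w\<in>V. v \<otimes> w \<in> U"
        by (rule sym_nbhds_square[OF U])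
      have VG: "V \<subseteq> carrier G" using sym_nbhds_carrier[OF V(1)] .
      obtain A where A: "small V A" "\<forall>\<^sub>F C in p. C \<in> A" by (rule cauchy_small[OF p V(1)])
      obtain B where B: "small V B" "\<forall>\<^sub>F C in q. C \<in> B" by (rule cauchy_small[OF q V(1)])
      obtain C where C: "C \<in> A" "C \<in> B" using meet A(2) B(2) pq by (auto simp: basic_def)
      have "\<exists>u\<in>U. D' = u <# D" if DD': "D \<in> A \<union> B" "D' \<in> A \<union> B" for D D'
      proof -
        obtain v where v: "v \<in> V" "C = v <# D"
          using DD'(1) by (elim UnE) (erule small_translate[OF A(1) _ C(1)] small_translate[OF B(1) _ C(2)], blast)+
        obtain w where w: "w \<in> V" "D' = w <# C"
          using DD'(2) by (elim UnE) (erule small_translate[OF A(1) C(1)] small_translate[OF B(1) C(2)], blast)+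
        have "D \<in> lcosets H" using DD'(1) small_cosets[OF A(1)] small_cosets[OF B(1)] by blast
        then have "D' = (w \<otimes> v) <# D" using coset_mult v w VG by auto
        then show ?thesis using V(2) v(1) w(1) by blast
      qed
      then have "small U (A \<union> B)" using A(1) B(1) by (simp add: small_def)
      moreover have "\<forall>\<^sub>F C in sup p q. C \<in> A \<union> B"
        using A(2) B(2) by (auto simp: eventually_sup elim!: eventually_mono)
      ultimately show "\<exists>A. small U A \<and> (\<forall>\<^sub>F C in sup p q. C \<in> A)" by blast
    qed
    then have "sup p q = p" "sup p q = q"
      using completion_point_maximal pq by (metis sup_ge1, metis sup_ge2)
    then show False using pq by simp
  qed
  then obtain A B where AB: "p \<in> basic A" "q \<in> basic B" "A \<inter> B = {}" by blast
  have "basic {} = {}"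
    using cauchyD(1)[OF completion_point_cauchy] by (auto simp: basic_def eventually_False)
  then have "disjnt (basic A) (basic B)"
    using AB(3) by (simp add: disjnt_def flip: basic_Int)
  then show "\<exists>U V. openin Y U \<and> openin Y V \<and> p \<in> U \<and> q \<in> V \<and> disjnt U V"
    using AB openin_basic by blast
qed

end


section \<open>The completion as a flow\<close>

lemma continuous_map_prodI:
  assumes closed: "\<And>x y. x \<in> topspace X \<Longrightarrow> y \<in> topspace Y \<Longrightarrow> f x y \<in> topspace Z"
    and nbhd: "\<And>x y W. x \<in> topspace X \<Longrightarrow> y \<in> topspace Y \<Longrightarrow> openin Z W \<Longrightarrow> f x y \<in> W \<Longrightarrow>
      \<exists>A B. openin X A \<and> openin Y B \<and> x \<in> A \<and> y \<in> B \<and> (\<forall>a\<in>A. \<forall>b\<in>B. f a b \<in> W)"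
  shows "continuous_map (prod_topology X Y) Z (\<lambda>(x, y). f x y)"
  unfolding continuous_map_def
proof (intro conjI allI impI)
  show "(\<lambda>(x, y). f x y) \<in> topspace (prod_topology X Y) \<rightarrow> topspace Z" using closed by auto
  fix W assume W: "openin Z W"
  show "openin (prod_topology X Y) {p \<in> topspace (prod_topology X Y). (\<lambda>(x, y). f x y) p \<in> W}" (is "openin _ ?P")
    unfolding openin_prod_topology_alt
  proof (intro allI impI)
    fix x y assume "(x, y) \<in> ?P"
    then have xy: "x \<in> topspace X" "y \<in> topspace Y" "f x y \<in> W" by auto
    obtain A B where AB: "openin X A" "openin Y B" "x \<in> A" "y \<in> B" "\<forall>a\<in>A. \<forall>b\<in>B. f a b \<in> W"
      using nbhd[OF xy(1,2) W xy(3)] by blast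
    then have "A \<times> B \<subseteq> ?P"
      using openin_subset[OF AB(1)] openin_subset[OF AB(2)] by auto
    then show "\<exists>A B. openin X A \<and> openin Y B \<and> x \<in> A \<and> y \<in> B \<and> A \<times> B \<subseteq> ?P"
      using AB by blast
  qed
qed

context topological_subgroup
begin

lemma act_eq: "p \<in> topspace Y \<Longrightarrow> act g p = filtermap (\<lambda>C. g <# C) p"
  by (simp add: coset_completion_action_def)

lemma translate_translate:
  assumes "\<forall>\<^sub>F C in F. C \<in> lcosets H" "g \<in> carrier G" "h \<in> carrier G"
  shows "filtermap (\<lambda>C. g <# C) (filtermap (\<lambda>C. h <# C) F) = filtermap (\<lambda>C. (g \<otimes> h) <# C) F"
  unfolding filter_eq_iff eventually_filtermap
proof
  fix P :: "'a set \<Rightarrow> bool"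
  have "\<forall>\<^sub>F C in F. P (g <# (h <# C)) = P ((g \<otimes> h) <# C)"
    using assms(1) by (rule eventually_mono) (simp add: coset_mult[OF assms(2,3)])
  then show "(\<forall>\<^sub>F C in F. P (g <# (h <# C))) = (\<forall>\<^sub>F C in F. P ((g \<otimes> h) <# C))"
    by (rule eventually_subst)
qed

lemma translate_one:
  assumes "\<forall>\<^sub>F C in F. C \<in> lcosets H"
  shows "filtermap (\<lambda>C. \<one> <# C) F = F"
  unfolding filter_eq_iff eventually_filtermap
proof
  fix P :: "'a set \<Rightarrow> bool"
  have "\<forall>\<^sub>F C in F. P (\<one> <# C) = P C"
    using assms by (rule eventually_mono) (simp add: coset_one)
  then show "(\<forall>\<^sub>F C in F. P (\<one> <# C)) = (\<forall>\<^sub>F C in F. P C)"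
    by (rule eventually_subst)
qed

text \<open>Left translation by \<open>g\<close> is uniformly continuous, because it turns the entourage of \<open>V\<close> into that of
  \<open>g V g\<inverse>\<close>.\<close>

lemma cauchy_translate:
  assumes F: "cauchy F" and g: "g \<in> carrier G"
  shows "cauchy (filtermap (\<lambda>C. g <# C) F)"
  unfolding cauchy_iff
proof (intro conjI ballI)
  show "filtermap (\<lambda>C. g <# C) F \<noteq> bot" using cauchyD(1)[OF F] by (simp add: filtermap_bot_iff)
  show "\<forall>\<^sub>F C in filtermap (\<lambda>C. g <# C) F. C \<in> lcosets H"
    unfolding eventually_filtermap using cauchyD(2)[OF F] by (rule eventually_mono) (rule coset_closed[OF g])
  fix U assume "U \<in> sym_nbhds"
  then obtain V where V: "V \<in> sym_nbhds" "\<forall>v\<in>V. g \<otimes> v \<otimes> inv g \<in> U"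
    using g by (rule sym_nbhds_conjugate)
  obtain A where A: "small V A" "\<forall>\<^sub>F C in F. C \<in> A" by (rule cauchy_small[OF F V(1)])
  have "small U ((\<lambda>C. g <# C) ` A)"
    unfolding small_def
  proof (intro conjI ballI)
    show "(\<lambda>C. g <# C) ` A \<subseteq> lcosets H" using small_cosets[OF A(1)] coset_closed[OF g] by auto
    fix C' D' assume "C' \<in> (\<lambda>C. g <# C) ` A" "D' \<in> (\<lambda>C. g <# C) ` A"
    then obtain C D where CD: "C' = g <# C" "D' = g <# D" "C \<in> A" "D \<in> A" by blast
    obtain v where v: "v \<in> V" "D = v <# C" by (rule small_translate[OF A(1) CD(3,4)])
    have "v \<in> carrier G" "C \<in> lcosets H" using v(1) sym_nbhds_carrier[OF V(1)] small_cosets[OF A(1) CD(3)] by auto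
    then have "D' = (g \<otimes> v \<otimes> inv g) <# C'"
      unfolding CD(1,2) v(2)
      using g coset_mult[of "g \<otimes> v" "inv g" "g <# C"] coset_mult[of g v C] coset_inv(1)[OF g] coset_closed by simp
    then show "\<exists>u\<in>U. D' = u <# C'" using V(2) v(1) by blast
  qed
  moreover have "\<forall>\<^sub>F C in filtermap (\<lambda>C. g <# C) F. C \<in> (\<lambda>C. g <# C) ` A"
    unfolding eventually_filtermap using A(2) by (rule eventually_mono) (rule imageI)
  ultimately show "\<exists>A. small U A \<and> (\<forall>\<^sub>F C in filtermap (\<lambda>C. g <# C) F. C \<in> A)" by blast
qed

text \<open>A Cauchy filter above the translate of \<open>p\<close> by \<open>g\<close> becomes one above \<open>p\<close> after translation by
  \<open>inv g\<close>, and the only such filter is \<open>p\<close>.\<close>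

lemma act_closed:
  assumes g: "g \<in> carrier G" and p: "p \<in> topspace Y"
  shows "act g p \<in> topspace Y"
proof -
  let ?t = "\<lambda>g :: 'a. filtermap (\<lambda>C. g <# C)"
  have cp: "cauchy p" using completion_point_cauchy[OF p] .
  have c: "cauchy (?t g p)" using cauchy_translate[OF cp g] .
  have cr: "cauchy (rounding (?t g p))" using cauchy_rounding[OF c] .
  have "?t (inv g) (?t g p) \<le> ?t (inv g) (rounding (?t g p))"
    using le_rounding[OF cauchyD(2)[OF c]] by (rule filtermap_mono)
  then have "p \<le> ?t (inv g) (rounding (?t g p))"
    using translate_translate[OF cauchyD(2)[OF cp], of "inv g" g] translate_one[OF cauchyD(2)[OF cp]] g by simp
  then have "?t (inv g) (rounding (?t g p)) = p"
    using completion_point_maximal[OF p cauchy_translate[OF cr]] g by simp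
  then have "?t g p = ?t g (?t (inv g) (rounding (?t g p)))" by simp
  also have "\<dots> = rounding (?t g p)"
    using translate_translate[OF cauchyD(2)[OF cr], of g "inv g"] translate_one[OF cauchyD(2)[OF cr]] g by simp
  finally show ?thesis
    using rounding_completion_point[OF c] act_eq[OF p] by simp
qed

lemma completion_group_action: "group_action G (topspace Y) act"
proof (rule group_actionI[OF is_group])
  show "act g \<in> extensional (topspace Y)" for g by (simp add: coset_completion_action_def)
  fix p assume p: "p \<in> topspace Y"
  note c = cauchyD(2)[OF completion_point_cauchy[OF p]]
  show "act \<one> p = p" using act_eq[OF p] translate_one[OF c] by simp
  fix g h assume gh: "g \<in> carrier G" "h \<in> carrier G"
  show "act (g \<otimes> h) p = act g (act h p)"
    using act_eq[OF p] act_eq[OF act_closed[OF gh(2) p]] translate_translate[OF c gh] by simp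
qed (rule act_closed)

text \<open>Joint continuity at \<open>(g, p)\<close>: roundness of \<open>g p\<close> leaves room for a neighbourhood \<open>U\<close> of the
  identity, and every \<open>x\<close> in \<open>U g\<close> is \<open>g\<close> followed by an element of \<open>U\<close>.\<close>

lemma completion_action_continuous: "continuous_map (prod_topology T Y) Y (\<lambda>(g, p). act g p)"
proof (rule continuous_map_prodI)
  fix g p assume "g \<in> topspace T" and p: "p \<in> topspace Y"
  then have g: "g \<in> carrier G" by (simp add: topspace_eq)
  then show gp: "act g p \<in> topspace Y" using act_closed p by simp
  fix W assume "openin Y W" "act g p \<in> W"
  then obtain A where A: "act g p \<in> basic A" "basic A \<subseteq> W"
    unfolding openin_completion_iff by blast
  then have "\<forall>\<^sub>F C in rounding (act g p). C \<in> A"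
    using gp by (simp add: basic_def completion_point_iff)
  then obtain U B where UB: "U \<in> sym_nbhds" "\<forall>\<^sub>F C in act g p. C \<in> B" "\<forall>u\<in>U. \<forall>C\<in>B. u <# C \<in> A"
    unfolding eventually_rounding by blast
  let ?N = "{x \<in> carrier G. x \<otimes> inv g \<in> U}" and ?B = "{C \<in> lcosets H. g <# C \<in> B}"
  have "openin T ?N" by (rule openin_translate[OF sym_nbhds_openin[OF UB(1)] g])
  moreover have "g \<in> ?N" using g sym_nbhds_one[OF UB(1)] by simp
  moreover have "p \<in> basic ?B"
    using UB(2) p cauchyD(2)[OF completion_point_cauchy[OF p]]
    by (simp add: basic_def act_eq eventually_filtermap eventually_conj_iff)
  moreover have "act x q \<in> W" if x: "x \<in> ?N" and q: "q \<in> basic ?B" for x q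
  proof -
    have qY: "q \<in> topspace Y" and qB: "\<forall>\<^sub>F C in q. C \<in> ?B" using q by (auto simp: basic_def)
    have "x <# C \<in> A" if C: "C \<in> ?B" for C
    proof -
      have "x <# C = (x \<otimes> inv g) <# (g <# C)"
        using x C g coset_mult[of "x \<otimes> inv g" g C] by (simp add: m_assoc)
      then show ?thesis using UB(3) x C by simp
    qed
    then have "\<forall>\<^sub>F C in act x q. C \<in> A"
      unfolding act_eq[OF qY] eventually_filtermap using qB by (rule eventually_mono[rotated])
    then have "act x q \<in> basic A" using act_closed qY x by (simp add: basic_def)
    then show ?thesis using A(2) by blast
  qed
  ultimately show "\<exists>N B. openin T N \<and> openin Y B \<and> g \<in> N \<and> p \<in> B \<and> (\<forall>x\<in>N. \<forall>q\<in>B. act x q \<in> W)"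
    using openin_basic by blast
qed

text \<open>The canonical map from the coset space to its completion.\<close>

definition coset_point :: "'a set \<Rightarrow> 'a set filter"
  where "coset_point C = rounding (principal {C})"

lemma eventually_coset_point:
  "eventually P (coset_point C) \<longleftrightarrow> (\<exists>U\<in>sym_nbhds. \<forall>u\<in>U. P (u <# C))"
  unfolding coset_point_def eventually_rounding eventually_principal by auto

lemma coset_point_in_completion:
  assumes C: "C \<in> lcosets H"
  shows "coset_point C \<in> topspace Y"
  unfolding coset_point_def
proof (rule rounding_completion_point)
  have "small U {C}" if "U \<in> sym_nbhds" for U
    using C sym_nbhds_one[OF that] coset_one[OF C] by (auto simp: small_def)
  then show "cauchy (principal {C})"
    using C unfolding cauchy_iff eventually_principal by (auto simp: principal_eq_bot_iff)
qed

lemma completion_flow: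
  assumes "co_precompact G T H"
  shows "flow G T Y act"
  unfolding flow_def
  using assms coset_point_in_completion[OF H_coset] Hausdorff_completion
    completion_group_action completion_action_continuous
  by (auto simp: co_precompact_def)

lemma act_coset_point:
  assumes g: "g \<in> carrier G" and C: "C \<in> lcosets H"
  shows "act g (coset_point C) = coset_point (g <# C)"
proof -
  have cC: "cauchy (coset_point C)" using completion_point_cauchy[OF coset_point_in_completion[OF C]] .
  have "\<forall>\<^sub>F D in coset_point (g <# C). P D" if P: "\<forall>\<^sub>F D in coset_point C. P (g <# D)" for P
  proof -
    obtain V where V: "V \<in> sym_nbhds" "\<forall>v\<in>V. P (g <# (v <# C))"
      using P unfolding eventually_coset_point by blast
    have "inv g \<in> carrier G" using g by simp
    then obtain U where U: "U \<in> sym_nbhds" "\<forall>u\<in>U. inv g \<otimes> u \<otimes> inv (inv g) \<in> V"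
      by (rule sym_nbhds_conjugate[OF V(1)])
    have "P (u <# (g <# C))" if u: "u \<in> U" for u
    proof -
      have uG: "u \<in> carrier G" using u sym_nbhds_carrier[OF U(1)] by auto
      have "g <# ((inv g \<otimes> u \<otimes> g) <# C) = u <# (g <# C)"
        using g uG C coset_mult by (simp add: m_assoc[symmetric])
      then show ?thesis using V(2) U(2) u g by (metis inv_inv)
    qed
    then show ?thesis using U(1) unfolding eventually_coset_point by blast
  qed
  then have "coset_point (g <# C) \<le> act g (coset_point C)"
    unfolding act_eq[OF coset_point_in_completion[OF C]] le_filter_def eventually_filtermap by blast
  then show ?thesis
    using completion_point_maximal[OF coset_point_in_completion[OF coset_closed[OF g C]]
        completion_point_cauchy[OF act_closed[OF g coset_point_in_completion[OF C]]]] by simp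
qed

abbreviation "base_point \<equiv> coset_point H"

lemma base_point_fixed: "h \<in> H \<Longrightarrow> act h base_point = base_point"
  using act_coset_point[OF mem_carrier H_coset] coset_join3[OF mem_carrier subgroup_axioms] by simp

lemma basic_contains_coset_point:
  assumes "p \<in> basic A"
  obtains g where "g \<in> carrier G" "coset_point (g <# H) \<in> basic A"
proof -
  have p: "p \<in> topspace Y" "\<forall>\<^sub>F C in rounding p. C \<in> A"
    using assms by (auto simp: basic_def completion_point_iff)
  then obtain U B where UB: "U \<in> sym_nbhds" "\<forall>\<^sub>F C in p. C \<in> B" "\<forall>u\<in>U. \<forall>C\<in>B. u <# C \<in> A"
    unfolding eventually_rounding by blast
  obtain C where C: "C \<in> B" "C \<in> B" "C \<in> lcosets H"
    by (rule cauchy_ex[OF completion_point_cauchy[OF p(1)] UB(2,2)])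
  then obtain g where g: "g \<in> carrier G" "C = g <# H" by (auto simp: LCOSETS_def)
  have "\<forall>\<^sub>F D in coset_point C. D \<in> A"
    unfolding eventually_coset_point using UB(1,3) C(1) by blast
  then show ?thesis
    using g coset_point_in_completion[OF C(3)] by (intro that[of g]) (auto simp: basic_def)
qed

lemma base_point_orbit_dense: "Y closure_of orbit G act base_point = topspace Y"
proof (intro equalityI subsetI)
  fix p assume p: "p \<in> topspace Y"
  show "p \<in> Y closure_of orbit G act base_point"
    unfolding in_closure_of
  proof (intro conjI p allI impI)
    fix V assume "p \<in> V \<and> openin Y V"
    then obtain A where A: "p \<in> basic A" "basic A \<subseteq> V" unfolding openin_completion_iff by blast
    obtain g where g: "g \<in> carrier G" "coset_point (g <# H) \<in> basic A"
      by (rule basic_contains_coset_point[OF A(1)])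
    have "coset_point (g <# H) \<in> orbit G act base_point"
      unfolding orbit_def using g(1) act_coset_point[OF g(1) H_coset] by (intro CollectI exI[of _ g]) simp
    then show "\<exists>q. q \<in> orbit G act base_point \<and> q \<in> V" using g(2) A(2) by blast
  qed
qed (rule subsetD[OF closure_of_subset_topspace])

text \<open>Finitely many translates \<open>f V H\<close> cover \<open>G\<close>, so a translate of \<open>p\<close> by some \<open>inv f\<close> comes close to the
  base point.  Hence \<open>S\<close>, which is closed and contains that translate, contains the base point.\<close>

lemma pre_syndetic_base_point:
  assumes ps: "pre_syndetic G T H" and S: "subflow G Y act S"
  shows "base_point \<in> S"
proof (rule ccontr)
  assume not: "base_point \<notin> S"
  have SY: "closedin Y S" "S \<subseteq> topspace Y" "S \<noteq> {}" using S closedin_subset by (auto simp: subflow_def)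
  have "openin Y (topspace Y - S)" using SY(1) by blast
  moreover have "base_point \<in> topspace Y - S" using not coset_point_in_completion[OF H_coset] by simp
  ultimately obtain A where A: "base_point \<in> basic A" "basic A \<subseteq> topspace Y - S"
    unfolding openin_completion_iff by blast
  then have "\<forall>\<^sub>F C in base_point. C \<in> A" by (simp add: basic_def)
  then obtain U where U: "U \<in> sym_nbhds" "\<forall>u\<in>U. u <# H \<in> A"
    unfolding eventually_coset_point by blast
  obtain V where V: "V \<in> sym_nbhds" "\<forall>v\<in>V. \<forall>w\<in>V. v \<otimes> w \<in> U"
    by (rule sym_nbhds_square[OF U(1)])
  have VG: "V \<subseteq> carrier G" using sym_nbhds_carrier[OF V(1)] .
  obtain F where F: "finite F" "F \<subseteq> carrier G" "F <#> V <#> H = carrier G"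
    using ps[unfolded pre_syndetic_def, rule_format, of V] sym_nbhds_openin[OF V(1)] sym_nbhds_one[OF V(1)] VG
    by blast
  obtain p where p: "p \<in> S" using SY(3) by blast
  then have pY: "p \<in> topspace Y" using SY(2) by blast
  have cover: "\<exists>f\<in>F. \<exists>v\<in>V. inv f <# C = v <# H" if C: "C \<in> lcosets H" for C
  proof -
    obtain g where g: "g \<in> carrier G" "C = g <# H" using C by (auto simp: LCOSETS_def)
    have "g \<in> F <#> V <#> H" using F(3) g(1) by simp
    then obtain f v h where fvh: "f \<in> F" "v \<in> V" "h \<in> H" "g = f \<otimes> v \<otimes> h"
      unfolding set_mult_def by blast
    have fvG: "f \<in> carrier G" "v \<in> carrier G" "h \<in> carrier G" using fvh F(2) VG by auto
    have "C = (f \<otimes> v) <# (h <# H)"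
      using g(2) fvh(4) fvG lcos_m_assoc[OF subset] by simp
    then have "C = f <# (v <# H)"
      using coset_join3[OF fvG(3) subgroup_axioms fvh(3)] fvG lcos_m_assoc[OF subset] by simp
    then have "inv f <# C = v <# H"
      using coset_inv(1)[OF fvG(1) coset_closed[OF fvG(2) H_coset]] by simp
    then show ?thesis using fvh(1,2) by blast
  qed
  \<comment> \<open>\<open>p\<close> need not contain one of the finitely many sets \<open>f V H\<close>, but it cannot contain all their
    complements.\<close>
  have "\<exists>f\<in>F. \<not> (\<forall>\<^sub>F C in p. \<not> (\<exists>v\<in>V. inv f <# C = v <# H))"
  proof (rule ccontr)
    assume "\<not> ?thesis"
    then have "\<forall>\<^sub>F C in p. \<forall>f\<in>F. \<not> (\<exists>v\<in>V. inv f <# C = v <# H)"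
      using F(1) by (simp add: eventually_ball_finite_distrib)
    then have "\<forall>\<^sub>F C in p. False"
      using cauchyD(2)[OF completion_point_cauchy[OF pY]] by eventually_elim (use cover in blast)
    then show False using cauchyD(1)[OF completion_point_cauchy[OF pY]] by (simp add: eventually_False)
  qed
  then obtain f where f: "f \<in> F" and freq: "\<not> (\<forall>\<^sub>F C in p. \<not> (\<exists>v\<in>V. inv f <# C = v <# H))" by blast
  have fG: "inv f \<in> carrier G" using f F(2) by auto
  let ?q = "act (inv f) p"
  have q: "?q \<in> S" using S p fG by (auto simp: subflow_def)
  then have qY: "?q \<in> topspace Y" using SY(2) by blast
  obtain B where B: "small V B" "\<forall>\<^sub>F C in ?q. C \<in> B" by (rule cauchy_small[OF completion_point_cauchy[OF qY] V(1)])
  have "\<not> (\<forall>\<^sub>F D in ?q. \<not> (\<exists>v\<in>V. D = v <# H))"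
    using freq by (simp add: act_eq[OF pY] eventually_filtermap)
  moreover have "\<forall>\<^sub>F D in ?q. \<not> (\<exists>v\<in>V. D = v <# H)" if "\<forall>D\<in>B. \<not> (\<exists>v\<in>V. D = v <# H)"
    using B(2) by (rule eventually_mono) (rule that[rule_format])
  ultimately obtain D v where D: "D \<in> B" "v \<in> V" "D = v <# H" by blast
  have "C \<in> A" if C: "C \<in> B" for C
  proof -
    obtain w where w: "w \<in> V" "C = w <# D" by (rule small_translate[OF B(1) D(1) C])
    have "C = (w \<otimes> v) <# H"
      using w D(2,3) VG coset_mult[OF _ _ H_coset] by auto
    then show ?thesis using U(2) V(2) w(1) D(2) by blast
  qed
  then have "\<forall>\<^sub>F C in ?q. C \<in> A" using B(2) by (rule eventually_mono[rotated])
  then have "?q \<in> basic A" using qY by (simp add: basic_def)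
  then show False using A(2) q by blast
qed

end

section \<open>Extending orbit maps of fixed points\<close>

lemma compact_space_cluster_point:
  assumes X: "compact_space X" and F: "F \<noteq> bot" and f: "\<forall>\<^sub>F a in F. f a \<in> topspace X"
  obtains l where "l \<in> topspace X" "\<forall>W. openin X W \<longrightarrow> l \<in> W \<longrightarrow> (\<exists>\<^sub>F a in F. f a \<in> W)"
proof -
  let ?\<W> = "{W. openin X W \<and> (\<forall>\<^sub>F a in F. f a \<notin> W)}"
  have "\<not> topspace X \<subseteq> \<Union>?\<W>"
  proof
    assume "topspace X \<subseteq> \<Union>?\<W>"
    then obtain \<F> where \<F>: "finite \<F>" "\<F> \<subseteq> ?\<W>" "topspace X \<subseteq> \<Union>\<F>"
      using X[unfolded compact_space_alt, rule_format, of ?\<W>] by auto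
    have "\<forall>\<^sub>F a in F. \<forall>W\<in>\<F>. f a \<notin> W"
      by (rule eventually_ball_finite[OF \<F>(1)]) (use \<F>(2) in auto)
    then have "\<forall>\<^sub>F a in F. False"
      using f by eventually_elim (use \<F>(3) in auto)
    then show False using F by (simp add: eventually_False)
  qed
  then obtain l where l: "l \<in> topspace X" "l \<notin> \<Union>?\<W>" by (meson subsetI)
  then have "\<forall>W. openin X W \<longrightarrow> l \<in> W \<longrightarrow> (\<exists>\<^sub>F a in F. f a \<in> W)"
    unfolding frequently_def by auto
  with l(1) show ?thesis by (rule that)
qed

locale subgroup_flow = topological_subgroup G T H + G_flow G T X \<phi>
  for G (structure) and T and H and X :: "'x topology" and \<phi>
begin

definition fixed :: "'x set"
  where "fixed = {x \<in> topspace X. \<forall>h\<in>H. \<phi> h x = x}"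

lemma fixed_in_X: "x \<in> fixed \<Longrightarrow> x \<in> topspace X"
  by (simp add: fixed_def)

lemma closedin_fixed: "closedin X fixed"
proof -
  have "closedin X {x \<in> topspace X. \<phi> h x = x}" if "h \<in> H" for h
    using closedin_continuous_maps_eq[OF Hausdorff_X continuous_act[OF mem_carrier[OF that]] continuous_map_id]
    by simp
  moreover have ne: "H \<noteq> {}" using subgroup.one_closed[OF subgroup_axioms] by blast
  ultimately have "closedin X (\<Inter>h\<in>H. {x \<in> topspace X. \<phi> h x = x})"
    by (intro closedin_Inter) auto
  also have "(\<Inter>h\<in>H. {x \<in> topspace X. \<phi> h x = x}) = fixed"
    using ne by (auto simp: fixed_def)
  finally show ?thesis .
qed

text \<open>The map \<open>gH \<mapsto> g x\<close>.  On an \<open>H\<close>-fixed point \<open>x\<close> the choice of the representative is immaterial.\<close>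

definition at_coset :: "'a set \<Rightarrow> 'x \<Rightarrow> 'x"
  where "at_coset C x = \<phi> (SOME g. g \<in> C) x"

lemma at_coset_eq:
  assumes g: "g \<in> carrier G" and x: "x \<in> fixed"
  shows "at_coset (g <# H) x = \<phi> g x"
proof -
  have "(SOME k. k \<in> g <# H) \<in> g <# H"
    using lcos_self[OF g subgroup_axioms] by (rule someI)
  then obtain h where h: "h \<in> H" "(SOME k. k \<in> g <# H) = g \<otimes> h"
    by (auto simp: l_coset_def)
  have "\<phi> (g \<otimes> h) x = \<phi> g (\<phi> h x)"
    using composition_rule[OF fixed_in_X[OF x] g] h(1) by simp
  then show ?thesis
    using h x by (simp add: at_coset_def fixed_def)
qed

lemma at_coset_translate:
  assumes g: "g \<in> carrier G" and C: "C \<in> lcosets H" and x: "x \<in> fixed"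
  shows "at_coset (g <# C) x = \<phi> g (at_coset C x)"
proof -
  obtain k where k: "k \<in> carrier G" "C = k <# H" using C by (auto simp: LCOSETS_def)
  have "g <# C = (g \<otimes> k) <# H" using coset_mult[OF g k(1) H_coset] k(2) by simp
  then show ?thesis
    using at_coset_eq[OF _ x] k g composition_rule[OF fixed_in_X[OF x] g k(1)] by simp
qed

lemma at_coset_in_subflow:
  assumes "subflow G X \<phi> S" "x \<in> S" "x \<in> fixed" "C \<in> lcosets H"
  shows "at_coset C x \<in> S"
proof -
  obtain g where "g \<in> carrier G" "C = g <# H" using assms(4) by (auto simp: LCOSETS_def)
  then show ?thesis using at_coset_eq assms by (simp add: subflow_def image_subset_iff)
qed

lemma subflow_topspace: "subflow G X \<phi> (topspace X)"
  unfolding subflow_def using nonempty_X element_image by auto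

lemma at_coset_in_X: "x \<in> fixed \<Longrightarrow> C \<in> lcosets H \<Longrightarrow> at_coset C x \<in> topspace X"
  using at_coset_in_subflow[OF subflow_topspace] fixed_in_X by blast

text \<open>Compactness provides a cluster point, and along a Cauchy filter a cluster point is a limit: on a
  small set of cosets the values differ only by elements of \<open>G\<close> near the identity.\<close>

lemma at_coset_limit_exists:
  assumes p: "p \<in> topspace Y" and x: "x \<in> fixed"
  shows "\<exists>l. limitin X (\<lambda>C. at_coset C x) l p"
proof -
  have cp: "cauchy p" using completion_point_cauchy[OF p] .
  have "\<forall>\<^sub>F C in p. at_coset C x \<in> topspace X"
    using cauchyD(2)[OF cp] by (rule eventually_mono) (rule at_coset_in_X[OF x])
  then obtain l where l: "l \<in> topspace X"
    and cluster: "\<forall>W. openin X W \<longrightarrow> l \<in> W \<longrightarrow> (\<exists>\<^sub>F C in p. at_coset C x \<in> W)"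
    by (rule compact_space_cluster_point[OF compact_X cauchyD(1)[OF cp]])
  have "\<forall>\<^sub>F C in p. at_coset C x \<in> W" if W: "openin X W" "l \<in> W" for W
  proof -
    obtain U W' where U: "U \<in> sym_nbhds" and W': "openin X W'" "l \<in> W'"
      and UW: "\<forall>u\<in>U. \<forall>z\<in>W'. \<phi> u z \<in> W"
      by (rule act_near_identity[OF W])
    obtain A where A: "small U A" "\<forall>\<^sub>F C in p. C \<in> A" by (rule cauchy_small[OF cp U])
    have "\<exists>\<^sub>F C in p. at_coset C x \<in> W' \<and> C \<in> A"
      using cluster[rule_format, OF W'] A(2) by (rule frequently_eventually_frequently)
    then obtain C where C: "at_coset C x \<in> W'" "C \<in> A" by (auto dest: frequently_ex)
    have "at_coset D x \<in> W" if D: "D \<in> A" for D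
    proof -
      obtain u where u: "u \<in> U" "D = u <# C" by (rule small_translate[OF A(1) C(2) D])
      then have "at_coset D x = \<phi> u (at_coset C x)"
        using at_coset_translate[OF _ small_cosets[OF A(1) C(2)] x] sym_nbhds_carrier[OF U] by auto
      then show ?thesis using UW u(1) C(1) by simp
    qed
    then show ?thesis using A(2) by (rule eventually_mono[rotated])
  qed
  then have "limitin X (\<lambda>C. at_coset C x) l p" using l by (simp add: limitin_def)
  then show ?thesis by blast
qed

definition extend :: "'a set filter \<Rightarrow> 'x \<Rightarrow> 'x"
  where "extend p x = (THE l. limitin X (\<lambda>C. at_coset C x) l p)"

lemma extend_eq:
  assumes p: "p \<in> topspace Y" and l: "limitin X (\<lambda>C. at_coset C x) l p"
  shows "extend p x = l"
  unfolding extend_def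
  using l limitin_Hausdorff_unique[OF _ l cauchyD(1)[OF completion_point_cauchy[OF p]] Hausdorff_X]
  by (rule the_equality)

lemma limitin_extend:
  assumes "p \<in> topspace Y" "x \<in> fixed"
  shows "limitin X (\<lambda>C. at_coset C x) (extend p x) p"
  using at_coset_limit_exists[OF assms] extend_eq[OF assms(1)] by auto

lemma extend_in_subflow:
  assumes S: "subflow G X \<phi> S" "x \<in> S" and p: "p \<in> topspace Y" and x: "x \<in> fixed"
  shows "extend p x \<in> S"
proof (rule limitin_closedin[OF limitin_extend[OF p x]])
  show "closedin X S" using S(1) by (simp add: subflow_def)
  show "\<forall>\<^sub>F C in p. at_coset C x \<in> S"
    using cauchyD(2)[OF completion_point_cauchy[OF p]]
    by (rule eventually_mono) (rule at_coset_in_subflow[OF S x])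
qed (rule cauchyD(1)[OF completion_point_cauchy[OF p]])

lemma extend_base_point:
  assumes x: "x \<in> fixed"
  shows "extend base_point x = x"
proof (rule extend_eq[OF coset_point_in_completion[OF H_coset]])
  have "\<forall>\<^sub>F C in base_point. at_coset C x \<in> W" if W: "openin X W" "x \<in> W" for W
  proof -
    obtain U W' where U: "U \<in> sym_nbhds" and W': "openin X W'" "x \<in> W'"
      and UW: "\<forall>u\<in>U. \<forall>z\<in>W'. \<phi> u z \<in> W"
      by (rule act_near_identity[OF W])
    have "at_coset (u <# H) x \<in> W" if "u \<in> U" for u
      using that UW W'(2) at_coset_eq[OF _ x] sym_nbhds_carrier[OF U] by auto
    then show ?thesis using U unfolding eventually_coset_point by blast
  qed
  then show "limitin X (\<lambda>C. at_coset C x) x base_point"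
    using fixed_in_X[OF x] by (simp add: limitin_def)
qed

lemma extend_act:
  assumes g: "g \<in> carrier G" and p: "p \<in> topspace Y" and x: "x \<in> fixed"
  shows "extend (act g p) x = \<phi> g (extend p x)"
proof (rule extend_eq[OF act_closed[OF g p]])
  have lim: "limitin X (\<phi> g \<circ> (\<lambda>C. at_coset C x)) (\<phi> g (extend p x)) p"
    using continuous_act[OF g] limitin_extend[OF p x] by (rule continuous_map_limit)
  have ev: "\<forall>\<^sub>F C in p. at_coset (g <# C) x = \<phi> g (at_coset C x)"
    using cauchyD(2)[OF completion_point_cauchy[OF p]]
    by (rule eventually_mono) (rule at_coset_translate[OF g _ x])
  have "\<forall>\<^sub>F C in p. at_coset (g <# C) x \<in> W"
    if "\<forall>\<^sub>F C in p. (\<phi> g \<circ> (\<lambda>C. at_coset C x)) C \<in> W" for W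
    using that ev by eventually_elim simp
  then show "limitin X (\<lambda>C. at_coset C x) (\<phi> g (extend p x)) (act g p)"
    using lim unfolding limitin_def act_eq[OF p] eventually_filtermap by blast
qed

text \<open>Choose a coset \<open>C = gH\<close> in a small member \<open>A\<close> of \<open>p\<close> whose value \<open>g x\<close> is close to
  \<open>extend p x\<close>.  For \<open>y\<close> near \<open>x\<close> the point \<open>g y\<close> is still close, and for every \<open>q\<close> containing \<open>A\<close> all
  values along \<open>q\<close> are of the form \<open>u g y\<close> with \<open>u\<close> near the identity.  A closed neighbourhood \<open>K\<close>
  catches their limit.\<close>

theorem extend_continuous:
  "continuous_map (prod_topology Y (subtopology X fixed)) X (\<lambda>(p, x). extend p x)"
proof (rule continuous_map_prodI)
  fix p x assume p: "p \<in> topspace Y" and "x \<in> topspace (subtopology X fixed)"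
  then have x: "x \<in> fixed" by simp
  show "extend p x \<in> topspace X"
    using extend_in_subflow[OF subflow_topspace fixed_in_X[OF x] p x] .
  fix W assume W: "openin X W" "extend p x \<in> W"
  have "neighbourhood_base_of (closedin X) X"
    using neighbourhood_base_of_closedin compact_Hausdorff_imp_regular_space[OF compact_X Hausdorff_X] by blast
  then obtain V K where VK: "openin X V" "closedin X K" "extend p x \<in> V" "V \<subseteq> K" "K \<subseteq> W"
    using W unfolding neighbourhood_base_of by meson
  obtain U V' where U: "U \<in> sym_nbhds" and V': "openin X V'" "extend p x \<in> V'"
    and UV: "\<forall>u\<in>U. \<forall>z\<in>V'. \<phi> u z \<in> V"
    by (rule act_near_identity[OF VK(1,3)])
  have cp: "cauchy p" using completion_point_cauchy[OF p] .
  obtain A where A: "small U A" "\<forall>\<^sub>F C in p. C \<in> A" by (rule cauchy_small[OF cp U])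
  have "\<forall>\<^sub>F C in p. C \<in> {C. at_coset C x \<in> V'}"
    using limitinD[OF limitin_extend[OF p x] V'] by simp
  then obtain C where C: "C \<in> A" "C \<in> {C. at_coset C x \<in> V'}" "C \<in> lcosets H"
    by (rule cauchy_ex[OF cp A(2)])
  then obtain g where g: "g \<in> carrier G" "C = g <# H" by (auto simp: LCOSETS_def)
  let ?N = "{y \<in> topspace X. \<phi> g y \<in> V'} \<inter> fixed"
  have "openin X {y \<in> topspace X. \<phi> g y \<in> V'}"
    using openin_continuous_map_preimage[OF continuous_act[OF g(1)] V'(1)] .
  then have "openin (subtopology X fixed) ?N" by (auto simp: openin_subtopology)
  moreover have "x \<in> ?N" using C(2) g x at_coset_eq[OF g(1) x] fixed_in_X[OF x] by simp
  moreover have "p \<in> basic A" using p A(2) by (simp add: basic_def)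
  moreover have "extend q y \<in> W" if q: "q \<in> basic A" and y: "y \<in> ?N" for q y
  proof -
    have qY: "q \<in> topspace Y" "\<forall>\<^sub>F D in q. D \<in> A" and yf: "y \<in> fixed" and gy: "\<phi> g y \<in> V'"
      using q y by (auto simp: basic_def)
    have "at_coset D y \<in> K" if D: "D \<in> A" for D
    proof -
      obtain u where u: "u \<in> U" "D = u <# C" by (rule small_translate[OF A(1) C(1) D])
      then have "at_coset D y = \<phi> u (\<phi> g y)"
        using at_coset_translate[OF _ C(3) yf] at_coset_eq[OF g(1) yf] g(2) sym_nbhds_carrier[OF U] by auto
      then show ?thesis using UV u(1) gy VK(4) by auto
    qed
    then have "\<forall>\<^sub>F D in q. at_coset D y \<in> K" using qY(2) by (rule eventually_mono[rotated])
    then have "extend q y \<in> K"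
      using limitin_closedin[OF limitin_extend[OF qY(1) yf] VK(2)] cauchyD(1)[OF completion_point_cauchy[OF qY(1)]]
      by simp
    then show ?thesis using VK(5) by blast
  qed
  ultimately show "\<exists>A B. openin Y A \<and> openin (subtopology X fixed) B \<and> p \<in> A \<and> x \<in> B \<and>
      (\<forall>q\<in>A. \<forall>y\<in>B. extend q y \<in> W)"
    using openin_basic by blast
qed

lemma extend_flow_map:
  assumes x: "x \<in> fixed"
  shows "flow_map G Y act X \<phi> (\<lambda>p. extend p x)"
  unfolding flow_map_def
proof (intro conjI ballI)
  have "continuous_map Y (prod_topology Y (subtopology X fixed)) (\<lambda>p. (p, x))"
    using x fixed_in_X[OF x] by (auto intro!: continuous_map_pairedI)
  then have "continuous_map Y X ((\<lambda>(p, x). extend p x) \<circ> (\<lambda>p. (p, x)))"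
    using extend_continuous by (rule continuous_map_compose)
  then show "continuous_map Y X (\<lambda>p. extend p x)" by (simp add: o_def)
qed (rule extend_act[OF _ _ x])

lemma flow_map_eq_if_base_point:
  assumes f: "flow_map G Y act X \<phi> f" and f': "flow_map G Y act X \<phi> f'"
    and eq: "f base_point = f' base_point" and p: "p \<in> topspace Y"
  shows "f p = f' p"
proof (rule forall_in_closure_of_eq[where X = Y and Y = X and S = "orbit G act base_point" and f = f and g = f'])
  show "p \<in> Y closure_of orbit G act base_point" using p base_point_orbit_dense by simp
  show "Hausdorff_space X" by (rule Hausdorff_X)
  show "continuous_map Y X f" "continuous_map Y X f'" using f f' by (auto simp: flow_map_def)
  fix q assume "q \<in> orbit G act base_point"
  then obtain g where "g \<in> carrier G" "q = act g base_point" by (auto simp: orbit_def)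
  then show "f q = f' q"
    using f f' eq coset_point_in_completion[OF H_coset] by (simp add: flow_map_def)
qed

end


section \<open>Extremely amenable subgroups\<close>

lemma flow_map_compose:
  assumes "flow_map G X \<phi> Y \<psi> f" "flow_map G Y \<psi> Z \<zeta> h"
  shows "flow_map G X \<phi> Z \<zeta> (h \<circ> f)"
  using assms continuous_map_compose[of X Y f Z h] continuous_map_image_subset_topspace[of X Y f]
  unfolding flow_map_def by (auto simp: image_subset_iff)

lemma flow_map_id: "flow_map G X \<phi> X \<phi> id"
  by (simp add: flow_map_def)

locale amenable_subgroup = topological_subgroup G T H for G (structure) and T and H +
  assumes co_precompact: "co_precompact G T H"
    and extremely_amenable: "extremely_amenable (G\<lparr>carrier := H\<rparr>) (subtopology T H)"
begin

lemma completion_G_flow: "G_flow G T Y act"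
  using completion_flow[OF co_precompact] by unfold_locales

lemma subgroup_flowI:
  assumes "flow G T X \<phi>"
  shows "subgroup_flow G T H X \<phi>"
  using assms by unfold_locales

lemma fixed_point:
  assumes X: "flow G T X \<phi>"
    and S: "S \<noteq> {}" "closedin X S" "\<And>h x. h \<in> H \<Longrightarrow> x \<in> S \<Longrightarrow> \<phi> h x \<in> S"
  obtains x where "x \<in> S" "x \<in> subgroup_flow.fixed H X \<phi>"
proof -
  interpret X: subgroup_flow G T H X \<phi> by (rule subgroup_flowI[OF X])
  obtain x where "x \<in> S" "\<forall>h\<in>H. \<phi> h x = x"
    by (rule X.extremely_amenable_fixed_point[OF subgroup_axioms extremely_amenable S])
  then show ?thesis
    using S(2) closedin_subset by (intro that[of x]) (auto simp: X.fixed_def)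
qed

lemma fixed_point_in_subflow:
  assumes X: "flow G T X \<phi>" and S: "subflow G X \<phi> S"
  obtains x where "x \<in> S" "x \<in> subgroup_flow.fixed H X \<phi>"
proof (rule fixed_point[OF X])
  show "S \<noteq> {}" "closedin X S" using S by (auto simp: subflow_def)
  show "\<phi> h x \<in> S" if "h \<in> H" "x \<in> S" for h x
    using S mem_carrier[OF that(1)] that(2) by (auto simp: subflow_def)
qed (rule that)

text \<open>The almost periodic points are the image of \<open>M \<times> Fix\<^sub>H(X)\<close> for a single minimal subflow \<open>M\<close> of
  the completion.\<close>

theorem closedin_almost_periodic_points:
  assumes X: "flow G T X \<phi>"
  shows "closedin X (almost_periodic_points G T X \<phi>)"
proof -
  interpret X: subgroup_flow G T H X \<phi> by (rule subgroup_flowI[OF X])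
  interpret Y: G_flow G T Y act by (rule completion_G_flow)
  interpret Y': subgroup_flow G T H Y act by (rule subgroup_flowI[OF Y.flow])
  obtain M where M: "minimal_subflow G Y act M"
    by (rule Y.ex_minimal_subflow[OF Y'.subflow_topspace])
  then have sM: "subflow G Y act M" and MY: "M \<subseteq> topspace Y" "closedin Y M"
    using closedin_subset by (auto simp: minimal_subflow_def subflow_def)
  have "almost_periodic_points G T X \<phi> = (\<lambda>(p, x). X.extend p x) ` (M \<times> X.fixed)"
    unfolding X.almost_periodic_points_eq
  proof (intro equalityI subsetI)
    fix z assume "z \<in> \<Union>{S. minimal_subflow G X \<phi> S}"
    then obtain S where S: "minimal_subflow G X \<phi> S" "z \<in> S" by blast
    then have sS: "subflow G X \<phi> S" by (simp add: minimal_subflow_def)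
    obtain x where x: "x \<in> S" "x \<in> X.fixed" by (rule fixed_point_in_subflow[OF X sS])
    have "subflow G X \<phi> ((\<lambda>p. X.extend p x) ` M)"
      by (rule Y.flow_map_image_subflow[OF X X.extend_flow_map[OF x(2)] sM])
    moreover have "(\<lambda>p. X.extend p x) ` M \<subseteq> S"
      using X.extend_in_subflow[OF sS x(1) _ x(2)] MY(1) by blast
    ultimately have "(\<lambda>p. X.extend p x) ` M = S" using S(1) unfolding minimal_subflow_def by blast
    then show "z \<in> (\<lambda>(p, x). X.extend p x) ` (M \<times> X.fixed)" using S(2) x(2) by auto
  next
    fix z assume "z \<in> (\<lambda>(p, x). X.extend p x) ` (M \<times> X.fixed)"
    then obtain p x where px: "p \<in> M" "x \<in> X.fixed" "z = X.extend p x" by auto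
    have "minimal_subflow G X \<phi> ((\<lambda>p. X.extend p x) ` M)"
      by (rule Y.flow_map_image_minimal_subflow[OF X X.extend_flow_map[OF px(2)] M])
    then show "z \<in> \<Union>{S. minimal_subflow G X \<phi> S}" using px(1,3) by blast
  qed
  moreover have "compactin (prod_topology Y (subtopology X X.fixed)) (M \<times> X.fixed)"
    unfolding compactin_Times
    using closedin_compact_space[OF Y.compact_X MY(2)] closedin_compact_space[OF X.compact_X X.closedin_fixed]
    by (simp add: compactin_subtopology)
  then have "compactin X ((\<lambda>(p, x). X.extend p x) ` (M \<times> X.fixed))"
    using X.extend_continuous by (rule image_compactin)
  ultimately show ?thesis using compactin_imp_closedin[OF X.Hausdorff_X] by simp
qed

end

locale pre_syndetic_amenable_subgroup = amenable_subgroup +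
  assumes pre_syndetic: "pre_syndetic G T H"
begin

lemma completion_minimal_flow: "minimal_flow G T Y act"
  unfolding minimal_flow_def
proof (intro conjI allI impI)
  show "flow G T Y act" by (rule completion_flow[OF co_precompact])
  interpret Y: G_flow G T Y act by (rule completion_G_flow)
  fix S assume S: "subflow G Y act S"
  then have "topspace Y \<subseteq> S"
    using Y.subflow_orbit_closure_subset[OF S pre_syndetic_base_point[OF pre_syndetic S]] base_point_orbit_dense
    by simp
  then show "S = topspace Y" using S closedin_subset by (auto simp: subflow_def)
qed

lemma flow_map_onto_minimal_flow:
  assumes f: "flow_map G Y act X \<phi> f" and X: "minimal_flow G T X \<phi>"
  shows "f ` topspace Y = topspace X"
proof -
  interpret Y: subgroup_flow G T H Y act by (rule subgroup_flowI[OF completion_flow[OF co_precompact]])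
  have "flow G T X \<phi>" using X by (simp add: minimal_flow_def)
  then have "subflow G X \<phi> (f ` topspace Y)"
    using f Y.subflow_topspace by (rule Y.flow_map_image_subflow)
  then show ?thesis using X by (simp add: minimal_flow_def)
qed

lemma ex_flow_map_to_minimal_flow:
  assumes X: "minimal_flow G T X \<phi>"
  obtains f where "flow_map G Y act X \<phi> f"
proof -
  have fl: "flow G T X \<phi>" using X by (simp add: minimal_flow_def)
  interpret X: subgroup_flow G T H X \<phi> by (rule subgroup_flowI[OF fl])
  obtain x where "x \<in> X.fixed" by (rule fixed_point_in_subflow[OF fl X.subflow_topspace])
  then show ?thesis by (rule that[OF X.extend_flow_map])
qed

theorem completion_universal: "is_universal_minimal_flow G T Y act"
  unfolding is_universal_minimal_flow_def
  using completion_minimal_flow ex_flow_map_to_minimal_flow flow_map_onto_minimal_flow by metis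

text \<open>The right inverse must send the base point to an \<open>H\<close>-fixed point in the fibre of \<open>e\<close> over the base
  point.  That fibre is closed and \<open>H\<close>-invariant, so it has one.\<close>

lemma endomorphism_right_inverse:
  assumes e: "flow_map G Y act Y act e"
  obtains e' where "flow_map G Y act Y act e'" "\<forall>p\<in>topspace Y. e (e' p) = p"
proof -
  have fl: "flow G T Y act" by (rule completion_flow[OF co_precompact])
  interpret Y: subgroup_flow G T H Y act by (rule subgroup_flowI[OF fl])
  have ce: "continuous_map Y Y e" using e by (simp add: flow_map_def)
  have bY: "base_point \<in> topspace Y" by (rule coset_point_in_completion[OF H_coset])
  let ?S = "{q \<in> topspace Y. e q = base_point}"
  obtain q where q: "q \<in> ?S" "q \<in> Y.fixed"
  proof (rule fixed_point[OF fl, of ?S])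
    have "base_point \<in> e ` topspace Y"
      using flow_map_onto_minimal_flow[OF e completion_minimal_flow] bY by simp
    then show "?S \<noteq> {}" by auto
    show "closedin Y ?S"
      using closedin_continuous_maps_eq[OF Hausdorff_completion ce, of "\<lambda>_. base_point"] bY by simp
    show "act h q \<in> ?S" if "h \<in> H" "q \<in> ?S" for h q
      using that e act_closed[OF mem_carrier] base_point_fixed by (auto simp: flow_map_def)
  qed (rule that)
  let ?e' = "\<lambda>p. Y.extend p q"
  have e': "flow_map G Y act Y act ?e'" by (rule Y.extend_flow_map[OF q(2)])
  have "(e \<circ> ?e') base_point = id base_point"
    using q(1) Y.extend_base_point[OF q(2)] by simp
  then have "\<forall>p\<in>topspace Y. e (?e' p) = p"
    using Y.flow_map_eq_if_base_point[OF flow_map_compose[OF e' e] flow_map_id] by simp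
  then show ?thesis by (rule that[OF e'])
qed

lemma endomorphism_injective:
  assumes e: "flow_map G Y act Y act e"
  shows "inj_on e (topspace Y)"
proof -
  obtain e' where e': "flow_map G Y act Y act e'" "\<forall>p\<in>topspace Y. e (e' p) = p"
    by (rule endomorphism_right_inverse[OF e])
  have "e' ` topspace Y = topspace Y"
    by (rule flow_map_onto_minimal_flow[OF e'(1) completion_minimal_flow])
  then show ?thesis using e'(2) by (metis (no_types, lifting) imageE inj_onI)
qed

text \<open>Composing a map \<open>f\<close> from \<open>Y\<close> to \<open>M\<close> with a map back gives an endomorphism of \<open>Y\<close>, so \<open>f\<close> is
  injective; it is onto by minimality, and a continuous bijection of compact Hausdorff spaces is a
  homeomorphism.\<close>

theorem universal_minimal_flow_isomorphic:
  assumes M: "is_universal_minimal_flow G T M \<mu>"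
  shows "flow_isomorphic G Y act M \<mu>"
proof -
  have minM: "minimal_flow G T M \<mu>" using M by (simp add: is_universal_minimal_flow_def)
  obtain f where f: "flow_map G Y act M \<mu> f" by (rule ex_flow_map_to_minimal_flow[OF minM])
  obtain f' where f': "flow_map G M \<mu> Y act f'"
    using universal_minimal_flow_any_type[OF topspace_eq M completion_minimal_flow] by blast
  have "inj_on (f' \<circ> f) (topspace Y)"
    by (rule endomorphism_injective[OF flow_map_compose[OF f f']])
  then have "inj_on f (topspace Y)" by (rule inj_on_imageI2)
  moreover have "continuous_map Y M f" "Hausdorff_space M" "compact_space Y"
    using f minM co_precompact by (auto simp: flow_map_def minimal_flow_def flow_def co_precompact_def)
  ultimately have "homeomorphic_map Y M f"
    using flow_map_onto_minimal_flow[OF f minM] by (intro continuous_imp_homeomorphic_map)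
  then show ?thesis using f by (auto simp: flow_isomorphic_def)
qed

end

theorem proposition8p4:
  fixes G :: "('g, 'b) monoid_scheme" and T :: "'g topology" and H :: "'g set"
  assumes "topological_group G T"
    and "subgroup H G" and "closedin T H"
    and "co_precompact G T H"
    and "extremely_amenable (G\<lparr>carrier := H\<rparr>) (subtopology T H)"
  shows "CAP TYPE('x) G T \<and>
    (pre_syndetic G T H \<longrightarrow>
      is_universal_minimal_flow G T (coset_completion G T H) (coset_completion_action G T H) \<and>
      (\<forall>(M :: 'm topology) \<mu>. is_universal_minimal_flow G T M \<mu> \<longrightarrow>
         flow_isomorphic G (coset_completion G T H) (coset_completion_action G T H) M \<mu>))"
proof -
  interpret topological_group G T by (rule assms(1))
  interpret subgroup H G by (rule assms(2))
  interpret amenable_subgroup G T H by unfold_locales (rule assms(4), rule assms(5))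
  have "CAP TYPE('x) G T"
    unfolding CAP_def using closedin_almost_periodic_points by blast
  moreover have "is_universal_minimal_flow G T Y act \<and>
      (\<forall>(M :: 'm topology) \<mu>. is_universal_minimal_flow G T M \<mu> \<longrightarrow> flow_isomorphic G Y act M \<mu>)"
    if "pre_syndetic G T H"
  proof -
    interpret pre_syndetic_amenable_subgroup G T H by unfold_locales (rule that)
    show ?thesis using completion_universal universal_minimal_flow_isomorphic by blast
  qed
  ultimately show ?thesis by blast
qed

end
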